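(* The $h^*$-polynomial of any pseudo-symmetric simplicial reflexive polytope is $\gamma$-positive.
   Context: A lattice polytope $\mathcal{P}\subset\mathbb{R}^d$ is pseudo-symmetric if there exists a facet $\mathcal{F}$ of $\mathcal{P}$ such that $-\mathcal{F}$ is also a facet of $\mathcal{P}$; simplicial means every facet is a simplex. A $d$-dimensional lattice polytope is reflexive if the origin is its unique interior lattice point and its dual polytope $\{\mathbf{y}:\langle\mathbf{x},\mathbf{y}\rangle\le1\ \forall\mathbf{x}\in\mathcal{P}\}$ is a lattice polytope. The $h^*$-polynomial of a $d$-dimensional lattice polytope $\mathcal{P}\subset\mathbb{R}^d$ is defined by $1+\sum_{m\ge1}|m\mathcal{P}\cap\mathbb{Z}^d|x^m=h^*(\mathcal{P},x)/(1-x)^{d+1}$. A degree-$d$ polynomial $f$ is $\gamma$-positive if $f(x)=x^df(1/x)$ and $f=\sum_i\gamma_ix^i(1+x)^{d-2i}$ with $\gamma_i\ge0$. *)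

theory Defs
  imports "HOL-Analysis.Analysis" "HOL-Computational_Algebra.Polynomial_FPS"
begin

definition int_lattice :: "(real ^ 'n) set" where
  "int_lattice = {x. \<forall>i. x $ i \<in> \<int>}"

definition lattice_polytope :: "(real ^ 'n) set \<Rightarrow> bool" where
  "lattice_polytope P \<longleftrightarrow> (\<exists>V. finite V \<and> V \<subseteq> int_lattice \<and> P = convex hull V)"

definition pseudo_symmetric :: "(real ^ 'n) set \<Rightarrow> bool" where
  "pseudo_symmetric P \<longleftrightarrow> (\<exists>F. F facet_of P \<and> uminus ` F facet_of P)"

definition simplicial :: "(real ^ 'n) set \<Rightarrow> bool" where
  "simplicial P \<longleftrightarrow> (\<forall>F. F facet_of P \<longrightarrow> (\<exists>k. k simplex F))"

definition dual_polytope :: "(real ^ 'n) set \<Rightarrow> (real ^ 'n) set" where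
  "dual_polytope P = {y. \<forall>x\<in>P. x \<bullet> y \<le> 1}"

definition reflexive :: "(real ^ 'n) set \<Rightarrow> bool" where
  "reflexive P \<longleftrightarrow>
     lattice_polytope P \<and> aff_dim P = int CARD('n) \<and>
     interior P \<inter> int_lattice = {0} \<and>
     lattice_polytope (dual_polytope P)"

definition ehrhart_series :: "(real ^ 'n) set \<Rightarrow> real fps" where
  "ehrhart_series P =
     Abs_fps (\<lambda>m. if m = 0 then 1
                   else real (card ((\<lambda>x. real m *\<^sub>R x) ` P \<inter> int_lattice)))"

text \<open>For a full-dimensional lattice polytope in real d-space such a polynomial exists by
  Ehrhart's theorem; uniqueness is the lemma below.\<close>

definition hstar_poly :: "(real ^ 'n) set \<Rightarrow> real poly" where
  "hstar_poly P =
     (THE h. ehrhart_series P = fps_of_poly h / (1 - fps_X) ^ (CARD('n) + 1))"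

lemma hstar_poly_eqI:
  fixes P :: "(real ^ 'n) set"
  assumes "ehrhart_series P = fps_of_poly h / (1 - fps_X) ^ (CARD('n) + 1)"
  shows "hstar_poly P = h"
  unfolding hstar_poly_def
proof (rule the_equality)
  fix g :: "real poly"
  let ?u = "(1 - fps_X :: real fps) ^ (CARD('n) + 1)"
  assume "ehrhart_series P = fps_of_poly g / ?u"
  with assms have eq: "fps_of_poly g / ?u = fps_of_poly h / ?u" by simp
  have u: "fps_nth ?u 0 \<noteq> 0" by (simp add: fps_nth_power_0)
  have "fps_of_poly g * inverse ?u = fps_of_poly h * inverse ?u"
    using eq by (simp only: fps_divide_unit[OF u])
  moreover have "inverse ?u \<noteq> 0"
    using inverse_mult_eq_1[OF u] by auto
  ultimately have "fps_of_poly g = fps_of_poly h"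
    by (metis mult_right_cancel)
  then show "g = h" by simp
qed (fact assms)

definition gamma_positive :: "real poly \<Rightarrow> bool" where
  "gamma_positive f \<longleftrightarrow>
     (let d = degree f in
       (\<forall>x. x \<noteq> 0 \<longrightarrow> poly f x = x ^ d * poly f (1 / x)) \<and>
       (\<exists>\<gamma> :: nat \<Rightarrow> real. (\<forall>i. \<gamma> i \<ge> 0) \<and>
          f = (\<Sum>i\<le>d div 2. smult (\<gamma> i) (monom 1 i * [:1, 1:] ^ (d - 2 * i)))))"

end

theory Submission
  imports Defs
begin

text \<open>
  Let \<open>v\<^sub>1, \<dots>, v\<^sub>d\<close> be the vertices of a facet \<open>F\<close> such that \<open>-F\<close> is a facet. Reflexivity makes all facet
  functionals integral, and comparing \<open>F\<close> with its neighbours shows that the vertices outside \<open>F \<union> -F\<close>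
  have coordinates in \<open>{-1, 0, 1}\<close> with respect to \<open>v\<close>. Simpliciality forces any two such vertices to
  have disjoint supports or to be opposite. After changing signs of the \<open>v\<^sub>i\<close>, the polytope is therefore the
  convex hull of \<open>\<plusminus>v\<^sub>i\<close> and of \<open>w\<^sub>B = \<Sum>i\<in>B. v\<^sub>i\<close> (and possibly \<open>-w\<^sub>B\<close>) for disjoint blocks \<open>B\<close> of even size,
  and lattice points have integral coordinates in the blocks and half-integral coordinates elsewhere.

  The gauge of \<open>P\<close> is the sum of the gauges of the blocks and of the absolute values of the other
  coordinates, so \<open>(1 - t)\<^sup>d \<Sum>x. t ^ gauge x\<close>, the sum ranging over lattice points, is a sum over sets \<open>S\<close> of
  half-integral coordinates of \<open>2 ^ |S| t ^ (|S|/2)\<close> times a product of powers of \<open>1 + t\<close> and block factors.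
  In a block of size \<open>2k\<close> the optimal multiple of \<open>w\<^sub>B\<close> is the lower median of the coordinates; counting gives
  the factor \<open>(1 + t)\<^sup>2\<^sup>k + l D\<^sub>k(t)\<close> with \<open>l = 1\<close> or \<open>2\<close>, where
  \<open>(1 - t) D\<^sub>k = \<Sum>p<k. (2k choose p) (t ^ (p + 1) - t ^ (2k - p))\<close>. Pascal's rule yields
  \<open>D\<^bsub>k+1\<^esub> = (1 + t)\<^sup>2 D\<^sub>k + (2k + 1 choose k) t ^ (k + 1)\<close>, hence all factors are gamma-positive.
\<close>

section \<open>Weight enumerators\<close>

text \<open>\<open>gf X g\<close> is the sum of \<open>t ^ g x\<close> over \<open>x\<close> in
  \<open>X\<close>. Finite levels keep \<open>card\<close> meaningful: it is 0 on infinite sets, so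
  sums and products of series would otherwise go wrong.\<close>

definition finite_levels :: "'a set \<Rightarrow> ('a \<Rightarrow> nat) \<Rightarrow> bool" where
  "finite_levels X g \<longleftrightarrow> (\<forall>m. finite {x\<in>X. g x = m})"

definition gf :: "'a set \<Rightarrow> ('a \<Rightarrow> nat) \<Rightarrow> real fps" where
  "gf X g = Abs_fps (\<lambda>m. real (card {x\<in>X. g x = m}))"

lemma finite_levels_subset:
  assumes "finite_levels Y g" "X \<subseteq> Y"
  shows "finite_levels X g"
proof -
  have "{x\<in>X. g x = m} \<subseteq> {x\<in>Y. g x = m}" for m using assms(2) by auto
  then show ?thesis using assms(1) unfolding finite_levels_def by (metis finite_subset)
qed

lemma gf_Un:
  assumes "finite_levels X g" "finite_levels Y g" "X \<inter> Y = {}"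
  shows "gf (X \<union> Y) g = gf X g + gf Y g"
proof (rule fps_ext)
  fix m
  have "{x \<in> X \<union> Y. g x = m} = {x\<in>X. g x = m} \<union> {x\<in>Y. g x = m}" by auto
  then show "fps_nth (gf (X \<union> Y) g) m = fps_nth (gf X g + gf Y g) m"
    using assms by (auto simp: gf_def finite_levels_def card_Un_disjoint disjoint_iff)
qed

lemma finite_levels_UN:
  assumes "finite I" "\<And>i. i \<in> I \<Longrightarrow> finite_levels (X i) g"
  shows "finite_levels (\<Union>i\<in>I. X i) g"
proof -
  have "{x \<in> \<Union> (X ` I). g x = m} = (\<Union>i\<in>I. {x\<in>X i. g x = m})" for m by auto
  then show ?thesis using assms by (simp add: finite_levels_def)
qed

lemma gf_UN:
  assumes "finite I" "\<And>i. i \<in> I \<Longrightarrow> finite_levels (X i) g"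
    "\<And>i j. i \<in> I \<Longrightarrow> j \<in> I \<Longrightarrow> i \<noteq> j \<Longrightarrow> X i \<inter> X j = {}"
  shows "gf (\<Union>i\<in>I. X i) g = (\<Sum>i\<in>I. gf (X i) g)"
  using assms
proof (induction I rule: finite_induct)
  case empty
  then show ?case by (simp add: gf_def fps_eq_iff)
next
  case (insert j I)
  have "X j \<inter> (\<Union>i\<in>I. X i) = {}"
    using insert.prems(2)[of j] insert.hyps by blast
  then show ?case using insert by (simp add: gf_Un finite_levels_UN)
qed

lemma gf_cong: "(\<And>x. x \<in> X \<Longrightarrow> g x = h x) \<Longrightarrow> gf X g = gf X h"
  unfolding gf_def by (auto intro!: fps_ext arg_cong[where f = card])

lemma bij_betw_levels:
  assumes "bij_betw h X Y" "\<And>x. x \<in> X \<Longrightarrow> g' (h x) = g x"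
  shows "bij_betw h {x\<in>X. g x = m} {y\<in>Y. g' y = m}"
proof (rule bij_betw_subset[OF assms(1)])
  have "Y = h ` X" using assms(1) by (simp add: bij_betw_def)
  then show "h ` {x\<in>X. g x = m} = {y\<in>Y. g' y = m}" using assms(2) by auto
qed auto

lemma gf_reindex:
  assumes "bij_betw h X Y" "\<And>x. x \<in> X \<Longrightarrow> g' (h x) = g x"
  shows "gf X g = gf Y g'"
  unfolding gf_def by (simp only: bij_betw_same_card[OF bij_betw_levels[of h X Y g' g, OF assms]])

lemma finite_levels_reindex:
  assumes "bij_betw h X Y" "\<And>x. x \<in> X \<Longrightarrow> g' (h x) = g x"
  shows "finite_levels X g = finite_levels Y g'"
  unfolding finite_levels_def by (simp only: bij_betw_finite[OF bij_betw_levels[of h X Y g' g, OF assms]])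

lemma
  assumes "finite_levels X g" "finite_levels Y h"
  shows finite_levels_Times: "finite_levels (X \<times> Y) (\<lambda>(x, y). g x + h y)"
    and gf_Times: "gf (X \<times> Y) (\<lambda>(x, y). g x + h y) = gf X g * gf Y h"
proof -
  define L where "L m i = {x\<in>X. g x = i} \<times> {y\<in>Y. h y = m - i}" for m i
  have eq: "{p \<in> X \<times> Y. (\<lambda>(x, y). g x + h y) p = m} = (\<Union>i\<in>{0..m}. L m i)" for m
    unfolding L_def by auto
  have fin: "finite (L m i)" for m i
    using assms by (auto simp: finite_levels_def L_def)
  show "finite_levels (X \<times> Y) (\<lambda>(x, y). g x + h y)"
    unfolding finite_levels_def eq using fin by auto
  have "card (\<Union>i\<in>{0..m}. L m i) = (\<Sum>i=0..m. card (L m i))" for m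
    using fin by (subst card_UN_disjoint) (auto simp: L_def)
  then show "gf (X \<times> Y) (\<lambda>(x, y). g x + h y) = gf X g * gf Y h"
    unfolding gf_def eq
    by (auto simp: L_def card_cartesian_product fps_mult_nth intro!: fps_ext)
qed

lemma gf_singleton: "gf {a} g = fps_X ^ g a"
proof -
  have "{x \<in> {a}. g x = m} = (if m = g a then {a} else {})" for m by auto
  then show ?thesis by (simp add: gf_def fps_eq_iff fps_X_power_nth)
qed

lemma finite_levels_finite: "finite X \<Longrightarrow> finite_levels X g"
  by (simp add: finite_levels_def)

lemma bij_betw_PiE_Un:
  assumes "A \<inter> B = {}"
  shows "bij_betw (\<lambda>z. (restrict z A, restrict z B)) (PiE (A \<union> B) X) (PiE A X \<times> PiE B X)"
proof (rule bij_betw_byWitness[where f' = "\<lambda>(x, y) i. if i \<in> A then x i else if i \<in> B then y i else undefined"],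
      goal_cases)
  case 1
  show ?case by (auto simp: fun_eq_iff PiE_def extensional_def)
next
  case 2
  show ?case using assms by (auto simp: fun_eq_iff PiE_def extensional_def restrict_def)
next
  case 3
  show ?case by (auto simp: PiE_def extensional_def)
next
  case 4
  show ?case by (auto simp: PiE_def extensional_def Pi_def split: if_splits)
qed

text \<open>Additive weights over disjoint blocks give products of series. Each \<open>G B\<close>
  sees the restriction to \<open>B\<close>, so it may depend on all coordinates of the block
  jointly, as the gauges below do.\<close>

lemma gf_PiE_partition:
  fixes X :: "'i \<Rightarrow> 'a set"
  assumes "finite \<F>" "disjoint \<F>" "\<And>B. B \<in> \<F> \<Longrightarrow> finite_levels (PiE B X) (G B)"
  shows "finite_levels (PiE (\<Union>\<F>) X) (\<lambda>z. \<Sum>B\<in>\<F>. G B (restrict z B)) \<and>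
    gf (PiE (\<Union>\<F>) X) (\<lambda>z. \<Sum>B\<in>\<F>. G B (restrict z B)) = (\<Prod>B\<in>\<F>. gf (PiE B X) (G B))"
  using assms
proof (induction \<F> rule: finite_induct)
  case empty
  then show ?case by (simp add: gf_singleton finite_levels_finite)
next
  case (insert A \<F>)
  have "A \<inter> B = {}" if "B \<in> \<F>" for B
    using disjointD[OF insert.prems(1), of A B] insert.hyps(2) that by auto
  then have dj: "A \<inter> \<Union>\<F> = {}" by auto
  have dF: "disjoint \<F>" using insert.prems(1) by (simp add: pairwise_insert)
  define S where "S = (\<lambda>z. \<Sum>B\<in>\<F>. G B (restrict z B))"
  have IH: "finite_levels (PiE (\<Union>\<F>) X) S"
    "gf (PiE (\<Union>\<F>) X) S = (\<Prod>B\<in>\<F>. gf (PiE B X) (G B))"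
    unfolding S_def using insert.IH[OF dF insert.prems(2)] by blast+
  have A: "finite_levels (PiE A X) (G A)" using insert.prems by auto
  have B: "bij_betw (\<lambda>z. (restrict z A, restrict z (\<Union>\<F>))) (PiE (\<Union>(insert A \<F>)) X) (PiE A X \<times> PiE (\<Union>\<F>) X)"
    using bij_betw_PiE_Un[OF dj] by simp
  have Z: "(\<lambda>(x, y). G A x + S y) (restrict z A, restrict z (\<Union>\<F>)) =
     (\<Sum>B\<in>insert A \<F>. G B (restrict z B))" for z
  proof -
    have "restrict (restrict z (\<Union>\<F>)) B = restrict z B" if "B \<in> \<F>" for B
      using that by (auto simp: fun_eq_iff)
    then have "S (restrict z (\<Union>\<F>)) = S z"
      unfolding S_def by simp
    then show ?thesis using insert.hyps by (simp add: S_def)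
  qed
  show ?case
    by (simp only: finite_levels_reindex[of _ _ _ "\<lambda>(x, y). G A x + S y", OF B Z]
      gf_reindex[of _ _ _ "\<lambda>(x, y). G A x + S y", OF B Z]
      finite_levels_Times[OF A IH(1)] gf_Times[OF A IH(1)] IH(2) prod.insert[OF insert.hyps] simp_thms)
qed

text \<open>Coordinatewise weights are the case of singleton blocks; \<open>the_elem\<close>
  recovers the index from its block.\<close>

lemma gf_PiE:
  fixes X :: "'i \<Rightarrow> 'a set"
  assumes "finite I" "\<And>i. i \<in> I \<Longrightarrow> finite_levels (X i) (g i)"
  shows "finite_levels (PiE I X) (\<lambda>z. \<Sum>i\<in>I. g i (z i)) \<and>
    gf (PiE I X) (\<lambda>z. \<Sum>i\<in>I. g i (z i)) = (\<Prod>i\<in>I. gf (X i) (g i))"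
proof -
  let ?G = "\<lambda>B z. g (the_elem B) (z (the_elem B))"
  have b: "bij_betw (\<lambda>z. z i) (PiE {i} X) (X i)" for i
    by (rule bij_betw_byWitness[where f' = "\<lambda>a. (\<lambda>j\<in>{i}. a)"])
       (auto simp: PiE_def extensional_def fun_eq_iff)
  have fl: "finite_levels (PiE {i} X) (?G {i})" and ge: "gf (PiE {i} X) (?G {i}) = gf (X i) (g i)"
    if "i \<in> I" for i
    using finite_levels_reindex[OF b, of i "g i" "?G {i}"] gf_reindex[OF b, of i "g i" "?G {i}"]
      assms(2)[OF that] by auto
  have U: "\<Union>((\<lambda>i. {i}) ` I) = I" by auto
  have inj: "inj_on (\<lambda>i. {i}) I" by auto
  have e: "(\<Sum>B\<in>(\<lambda>i. {i}) ` I. ?G B (restrict z B)) = (\<Sum>i\<in>I. g i (z i))" for z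
    by (subst sum.reindex[OF inj]) simp
  have e2: "(\<Prod>B\<in>(\<lambda>i. {i}) ` I. gf (PiE B X) (?G B)) = (\<Prod>i\<in>I. gf (X i) (g i))"
    unfolding prod.reindex[OF inj] comp_def by (rule prod.cong) (simp_all only: ge)
  have "finite_levels (PiE B X) (?G B)" if "B \<in> (\<lambda>i. {i}) ` I" for B
    using that fl by auto
  moreover have "disjoint ((\<lambda>i. {i}) ` I)" by (auto simp: disjoint_def)
  ultimately show ?thesis
    using gf_PiE_partition[of "(\<lambda>i. {i}) ` I" X ?G] assms(1)
    unfolding U e e2 by blast
qed

section \<open>Weight enumerators of single coordinates\<close>

lemma
  shows finite_levels_pos: "finite_levels {1::int..} nat"
    and gf_pos: "gf {1::int..} nat = fps_X * inverse (1 - fps_X)"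
proof -
  have e: "{x::int. 1 \<le> x \<and> nat x = m} = (if m = 0 then {} else {int m})" for m by auto
  show "finite_levels {1::int..} nat" by (simp add: finite_levels_def e)
  show "gf {1::int..} nat = fps_X * inverse (1 - fps_X)"
    by (rule fps_ext) (simp add: gf_def e fps_inverse_one_minus_fps_X)
qed

lemma gf_nonpos: "gf {..0::int} (\<lambda>x. nat (- x)) = inverse (1 - fps_X)"
proof -
  have e: "{x::int. x \<le> 0 \<and> nat (- x) = m} = {- int m}" for m by auto
  show ?thesis
    by (rule fps_ext) (simp add: gf_def e fps_inverse_one_minus_fps_X)
qed

lemma
  shows finite_levels_abs: "finite_levels X (\<lambda>x::int. nat \<bar>x\<bar>)"
    and gf_abs: "gf UNIV (\<lambda>x::int. nat \<bar>x\<bar>) = (1 + fps_X) * inverse (1 - fps_X)"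
proof -
  have U: "UNIV = {1::int..} \<union> {..0}" by auto
  have g: "gf {1::int..} (\<lambda>x. nat \<bar>x\<bar>) = gf {1::int..} nat"
    "gf {..0::int} (\<lambda>x. nat \<bar>x\<bar>) = gf {..0} (\<lambda>x. nat (- x))"
    by (auto intro: gf_cong)
  have "{x::int. nat \<bar>x\<bar> = m} \<subseteq> {- int m, int m}" for m by auto
  then have fl: "finite_levels UNIV (\<lambda>x::int. nat \<bar>x\<bar>)"
    unfolding finite_levels_def by (auto intro: finite_subset)
  then show fl': "finite_levels X (\<lambda>x::int. nat \<bar>x\<bar>)" for X
    by (rule finite_levels_subset) auto
  show "gf UNIV (\<lambda>x::int. nat \<bar>x\<bar>) = (1 + fps_X) * inverse (1 - fps_X)"
    unfolding U by (subst gf_Un) (auto simp: fl' g gf_pos gf_nonpos algebra_simps)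
qed

text \<open>The weight of \<open>z\<close> is \<open>\<bar>z + 1/2\<bar> - 1/2\<close>.\<close>
definition half_weight :: "int \<Rightarrow> nat" where
  "half_weight z = (if 0 \<le> z then nat z else nat (- z - 1))"

lemma
  shows finite_levels_half: "finite_levels UNIV half_weight"
    and gf_half: "gf UNIV half_weight = 2 * inverse (1 - fps_X)"
proof -
  have e: "{z::int. half_weight z = m} = {int m, - int m - 1}" for m
  proof -
    have "half_weight z = m \<longleftrightarrow> z = int m \<or> z = - int m - 1" for z
      by (cases "0 \<le> z") (auto simp: half_weight_def)
    then show ?thesis by auto
  qed
  have c: "card {int m, - int m - 1} = 2" for m
    by (simp add: card_insert_if)
  show "finite_levels UNIV half_weight" by (simp add: finite_levels_def e)
  show "gf UNIV half_weight = 2 * inverse (1 - fps_X)"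
    by (rule fps_ext) (simp only: gf_def e c fps_inverse_one_minus_fps_X mult_2 fps_add_nth fps_nth_Abs_fps
        mem_Collect_eq UNIV_I simp_thms of_nat_numeral one_add_one)
qed

section \<open>The block factors\<close>

text \<open>The terms of \<open>(1 + x) ^ n\<close> of degree below \<open>m\<close>.\<close>

definition binom_trunc :: "nat \<Rightarrow> nat \<Rightarrow> 'a::comm_ring_1 \<Rightarrow> 'a" where
  "binom_trunc n m x = (\<Sum>p<m. of_nat (n choose p) * x ^ p)"

lemma binom_trunc_Suc: "binom_trunc n (Suc m) x = binom_trunc n m x + of_nat (n choose m) * x ^ m"
  by (simp add: binom_trunc_def)

lemma binom_trunc_pascal:
  "x * binom_trunc n m x + binom_trunc n (Suc m) x = binom_trunc (Suc n) (Suc m) x"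
  by (induction m) (simp_all add: binom_trunc_Suc, simp_all add: binom_trunc_def algebra_simps)

lemma binom_trunc_mult:
  "(1 + x) * binom_trunc n (Suc m) x = binom_trunc (Suc n) (Suc m) x + of_nat (n choose m) * x ^ Suc m"
  using binom_trunc_pascal[of x n m] by (simp add: binom_trunc_Suc algebra_simps)

lemma binom_trunc_full: "binom_trunc n (Suc n) x = (1 + x) ^ n"
  by (simp add: binom_trunc_def binomial_ring[of x 1] lessThan_Suc_atMost add.commute[of 1])

lemma sum_subsets_card:
  fixes f :: "nat \<Rightarrow> 'a::comm_ring_1"
  assumes "finite B"
  shows "(\<Sum>U\<in>{U. U \<subseteq> B \<and> j \<le> card U}. f (card U)) = (\<Sum>p\<in>{j..card B}. of_nat (card B choose p) * f p)"
proof -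
  have "(\<Sum>U\<in>{U. U \<subseteq> B \<and> j \<le> card U}. f (card U)) =
      (\<Sum>p\<in>{j..card B}. \<Sum>U\<in>{U\<in>{U. U \<subseteq> B \<and> j \<le> card U}. card U = p}. f (card U))"
    using assms by (intro sum.group[symmetric]) (auto simp: card_mono)
  also have "\<dots> = (\<Sum>p\<in>{j..card B}. of_nat (card B choose p) * f p)"
  proof (rule sum.cong[OF refl])
    fix p assume "p \<in> {j..card B}"
    then have "{U\<in>{U. U \<subseteq> B \<and> j \<le> card U}. card U = p} = {U. U \<subseteq> B \<and> card U = p}" by auto
    then show "(\<Sum>U\<in>{U\<in>{U. U \<subseteq> B \<and> j \<le> card U}. card U = p}. f (card U)) =
        of_nat (card B choose p) * f p"
      using n_subsets[OF assms, of p] by simp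
  qed
  finally show ?thesis .
qed

text \<open>The recursion makes the gamma coefficients visibly nonnegative;
  \<open>block_poly_eq\<close> links it to the truncated binomials met in counting.\<close>

fun block_poly :: "nat \<Rightarrow> real poly" where
  "block_poly 0 = 0"
| "block_poly (Suc k) = [:1, 1:] ^ 2 * block_poly k + monom (of_nat (Suc (2 * k) choose k)) (Suc k)"

lemma fps_of_poly_linear_power: "fps_of_poly ([:1, 1:] ^ m) = (1 + fps_X :: real fps) ^ m"
  by (simp add: fps_of_poly_power fps_of_poly_pCons)

text \<open>Multiplying by \<open>1 + fps_X\<close> twice moves from row \<open>2 k + 1\<close> to
  row \<open>2 k + 3\<close> of Pascal's triangle. Truncation leaves middle binomial terms, and
  these cancel against the monomial in the recursion.\<close>

lemma block_poly_eq:
  "(1 - fps_X) * fps_of_poly (block_poly k) =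
     binom_trunc (Suc (2 * k)) (Suc k) fps_X - (1 + fps_X) ^ (2 * k)"
proof (induction k)
  case 0
  then show ?case by (simp add: binom_trunc_def)
next
  case (Suc k)
  let ?X = "fps_X :: real fps" and ?T = "\<lambda>n m. binom_trunc n m (fps_X :: real fps)"
  define a :: "real fps" where "a = of_nat (Suc (2 * k) choose k)"
  have sym: "Suc (2 * k) choose Suc k = Suc (2 * k) choose k"
    using binomial_symmetric[of k "Suc (2 * k)"] by (simp add: Suc_diff_le)
  \<comment> \<open>A central binomial coefficient is the sum of two equal neighbours in the row
    above.\<close>
  have b: "of_nat (Suc (Suc (2 * k)) choose Suc k) = a + a"
    using sym by (simp add: a_def)
  have m: "fps_of_poly (monom (of_nat (Suc (2 * k) choose k)) (Suc k)) = a * ?X ^ Suc k"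
    by (simp add: fps_of_poly_monom a_def fps_of_nat)
  have 1: "(1 + ?X) * ?T (Suc (2 * k)) (Suc k) = ?T (Suc (Suc (2 * k))) (Suc k) + a * ?X ^ Suc k"
    by (simp only: binom_trunc_mult a_def)
  have 2: "?T (Suc (Suc (2 * k))) (Suc (Suc k)) = ?T (Suc (Suc (2 * k))) (Suc k) + (a + a) * ?X ^ Suc k"
    by (simp only: binom_trunc_Suc[of _ "Suc k"] b)
  have 3: "(1 + ?X) * ?T (Suc (Suc (2 * k))) (Suc (Suc k)) =
     ?T (Suc (Suc (Suc (2 * k)))) (Suc (Suc k)) + (a + a) * ?X ^ Suc (Suc k)"
    by (simp only: binom_trunc_mult b)
  have "(1 - ?X) * fps_of_poly (block_poly (Suc k)) =
      (1 + ?X) ^ 2 * ((1 - ?X) * fps_of_poly (block_poly k)) + (1 - ?X) * (a * ?X ^ Suc k)"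
    unfolding block_poly.simps fps_of_poly_add m fps_of_poly_mult fps_of_poly_linear_power
    by (simp only: algebra_simps)
  also have "\<dots> = (1 + ?X) * ((1 + ?X) * ?T (Suc (2 * k)) (Suc k)) - (1 + ?X) ^ (2 * Suc k)
      + (1 - ?X) * (a * ?X ^ Suc k)"
    unfolding Suc.IH by (simp add: power2_eq_square algebra_simps)
  also have "(1 + ?X) * ((1 + ?X) * ?T (Suc (2 * k)) (Suc k)) =
     (1 + ?X) * (?T (Suc (Suc (2 * k))) (Suc (Suc k)) - a * ?X ^ Suc k)"
    unfolding 1 2 by (simp add: algebra_simps)
  also have "\<dots> = ?T (Suc (Suc (Suc (2 * k)))) (Suc (Suc k)) + (a + a) * ?X ^ Suc (Suc k)
      - (1 + ?X) * (a * ?X ^ Suc k)"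
    unfolding right_diff_distrib 3 ..
  finally show ?case by (simp add: algebra_simps)
qed

section \<open>Integer vectors in a block, sorted by signs\<close>

abbreviation int_vecs :: "'i set \<Rightarrow> ('i \<Rightarrow> int) set" where
  "int_vecs B \<equiv> PiE B (\<lambda>_. UNIV)"

definition l1 :: "'i set \<Rightarrow> ('i \<Rightarrow> int) \<Rightarrow> nat" where
  "l1 B z = (\<Sum>i\<in>B. nat \<bar>z i\<bar>)"

definition npos :: "'i set \<Rightarrow> ('i \<Rightarrow> int) \<Rightarrow> nat" where
  "npos B z = card {i\<in>B. 0 < z i}"

definition nneg :: "'i set \<Rightarrow> ('i \<Rightarrow> int) \<Rightarrow> nat" where
  "nneg B z = card {i\<in>B. z i < 0}"

lemma
  assumes "finite B"
  shows finite_levels_l1: "X \<subseteq> int_vecs B \<Longrightarrow> finite_levels X (l1 B)"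
    and gf_l1: "gf (int_vecs B) (l1 B) = (1 + fps_X) ^ card B * inverse (1 - fps_X) ^ card B"
proof -
  have l1: "l1 B = (\<lambda>z. \<Sum>i\<in>B. nat \<bar>z i\<bar>)" by (simp add: l1_def fun_eq_iff)
  note * = gf_PiE[OF assms, of "\<lambda>_. UNIV" "\<lambda>_ z. nat \<bar>z\<bar>", OF finite_levels_abs, folded l1]
  show "finite_levels X (l1 B)" if "X \<subseteq> int_vecs B"
    using * that finite_levels_subset by blast
  show "gf (int_vecs B) (l1 B) = (1 + fps_X) ^ card B * inverse (1 - fps_X) ^ card B"
    using * by (simp add: gf_abs power_mult_distrib)
qed

text \<open>Sort the vectors by the set \<open>U\<close> of their positive coordinates. A positive
  coordinate contributes \<open>t / (1 - t)\<close>, any other \<open>1 / (1 - t)\<close>, and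
  \<open>binom_trunc\<close> removes the sets with fewer than \<open>j\<close> elements.\<close>

lemma gf_npos_ge:
  assumes "finite B" "j \<le> Suc (card B)"
  shows "gf {z\<in>int_vecs B. j \<le> npos B z} (l1 B) =
    inverse (1 - fps_X) ^ card B * ((1 + fps_X) ^ card B - binom_trunc (card B) j fps_X)"
proof -
  define q :: "real fps" where "q = inverse (1 - fps_X)"
  define I where "I = {U. U \<subseteq> B \<and> j \<le> card U}"
  define R where "R U = PiE B (\<lambda>i. if i \<in> U then {1::int..} else {..0})" for U
  have Rpos: "{i\<in>B. 0 < z i} = U" if "z \<in> R U" "U \<subseteq> B" for z U
  proof -
    have "0 < z i \<longleftrightarrow> i \<in> U" if "i \<in> B" for i
      using PiE_mem[OF \<open>z \<in> R U\<close>[unfolded R_def] that] by (auto split: if_splits)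
    then show ?thesis using \<open>U \<subseteq> B\<close> by auto
  qed
  have Rin: "z \<in> R {i\<in>B. 0 < z i}" if "z \<in> int_vecs B" for z
    using that unfolding R_def by (auto simp: PiE_def)
  have eq: "{z\<in>int_vecs B. j \<le> npos B z} = (\<Union>U\<in>I. R U)"
  proof (intro set_eqI iffI)
    fix z assume "z \<in> {z\<in>int_vecs B. j \<le> npos B z}"
    then show "z \<in> (\<Union>U\<in>I. R U)"
      using Rin[of z] by (auto simp: I_def npos_def intro!: exI[of _ "{i\<in>B. 0 < z i}"])
  next
    fix z assume "z \<in> (\<Union>U\<in>I. R U)"
    then obtain U where "U \<in> I" "z \<in> R U" by auto
    then show "z \<in> {z\<in>int_vecs B. j \<le> npos B z}"
      using Rpos[of z U] by (auto simp: I_def npos_def R_def PiE_def)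
  qed
  have sub: "R U \<subseteq> int_vecs B" for U by (auto simp: R_def PiE_def)
  have gR: "gf (R U) (l1 B) = q ^ card B * fps_X ^ card U" if "U \<in> I" for U
  proof -
    have UB: "U \<subseteq> B" using that by (simp add: I_def)
    have g: "gf (if i \<in> U then {1::int..} else {..0}) (\<lambda>x. nat \<bar>x\<bar>) = (if i \<in> U then fps_X else 1) * q" for i
      using gf_cong[of "{1::int..}" "\<lambda>x. nat \<bar>x\<bar>" nat] gf_cong[of "{..0::int}" "\<lambda>x. nat \<bar>x\<bar>" "\<lambda>x. nat (- x)"]
      by (simp add: gf_pos gf_nonpos q_def)
    have "l1 B = (\<lambda>z. \<Sum>i\<in>B. nat \<bar>z i\<bar>)" by (simp add: l1_def fun_eq_iff)
    then have "gf (R U) (l1 B) = (\<Prod>i\<in>B. (if i \<in> U then fps_X else 1) * q)"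
      unfolding R_def
      using gf_PiE[OF assms(1), of "\<lambda>i. if i \<in> U then {1::int..} else {..0}" "\<lambda>_ z. nat \<bar>z\<bar>",
          OF finite_levels_abs] by (simp add: g)
    also have "\<dots> = q ^ card B * (\<Prod>i\<in>B. if i \<in> U then fps_X else 1)"
      by (simp add: prod.distrib mult.commute)
    also have "(\<Prod>i\<in>B. if i \<in> U then fps_X else (1::real fps)) = fps_X ^ card U"
      using UB assms(1) by (simp add: prod.If_cases Int_absorb1)
    finally show ?thesis .
  qed
  have "gf {z\<in>int_vecs B. j \<le> npos B z} (l1 B) = (\<Sum>U\<in>I. gf (R U) (l1 B))"
    unfolding eq
  proof (rule gf_UN)
    show "finite I" using assms(1) by (simp add: I_def)
    show "finite_levels (R U) (l1 B)" for U
      by (rule finite_levels_l1[OF assms(1) sub])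
    show "R U \<inter> R V = {}" if "U \<in> I" "V \<in> I" "U \<noteq> V" for U V
      using that Rpos unfolding I_def by blast
  qed
  also have "\<dots> = q ^ card B * (\<Sum>U\<in>I. fps_X ^ card U)"
    by (simp add: gR sum_distrib_left)
  also have "(\<Sum>U\<in>I. fps_X ^ card U) = (\<Sum>p\<in>{j..card B}. of_nat (card B choose p) * (fps_X :: real fps) ^ p)"
    unfolding I_def by (rule sum_subsets_card[OF assms(1)])
  also have "\<dots> = (1 + fps_X) ^ card B - binom_trunc (card B) j fps_X"
  proof -
    have "{..<Suc (card B)} = {..<j} \<union> {j..card B}" "{..<j} \<inter> {j..card B} = {}"
      using assms(2) by auto
    then have "binom_trunc (card B) (Suc (card B)) (fps_X :: real fps) = binom_trunc (card B) j fps_X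
      + (\<Sum>p\<in>{j..card B}. of_nat (card B choose p) * fps_X ^ p)"
      unfolding binom_trunc_def by (simp add: sum.union_disjoint del: lessThan_Suc sum.lessThan_Suc)
    then show ?thesis by (simp add: binom_trunc_full)
  qed
  finally show ?thesis unfolding q_def .
qed

definition neg_on :: "'i set \<Rightarrow> ('i \<Rightarrow> int) \<Rightarrow> 'i \<Rightarrow> int" where
  "neg_on B z = (\<lambda>i\<in>B. - z i)"

lemma npos_neg_on [simp]: "npos B (neg_on B z) = nneg B z"
  and nneg_neg_on [simp]: "nneg B (neg_on B z) = npos B z"
  and l1_neg_on [simp]: "l1 B (neg_on B z) = l1 B z"
  by (auto simp: npos_def nneg_def l1_def neg_on_def intro!: arg_cong[where f = card])

lemma bij_betw_neg_on: "bij_betw (neg_on B) {z\<in>int_vecs B. Q (neg_on B z)} {z\<in>int_vecs B. Q z}"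
proof (rule bij_betw_byWitness[where f' = "neg_on B"])
  have *: "neg_on B (neg_on B z) = z" if "z \<in> int_vecs B" for z
    using that by (auto simp: neg_on_def fun_eq_iff PiE_def extensional_def)
  have "neg_on B z \<in> int_vecs B" for z by (auto simp: neg_on_def)
  then show "neg_on B ` {z\<in>int_vecs B. Q (neg_on B z)} \<subseteq> {z\<in>int_vecs B. Q z}"
    "neg_on B ` {z\<in>int_vecs B. Q z} \<subseteq> {z\<in>int_vecs B. Q (neg_on B z)}"
    using * by auto
qed (auto simp: neg_on_def fun_eq_iff PiE_def extensional_def)

lemma gf_nneg_ge:
  "gf {z\<in>int_vecs B. j \<le> nneg B z} (l1 B) = gf {z\<in>int_vecs B. j \<le> npos B z} (l1 B)"
  by (rule gf_reindex[of "neg_on B"]) (use bij_betw_neg_on[of B "\<lambda>z. j \<le> npos B z"] in auto)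

lemma npos_nneg_le: "finite B \<Longrightarrow> npos B z + nneg B z \<le> card B"
  unfolding npos_def nneg_def
  by (subst card_Un_disjoint[symmetric]) (auto intro!: card_mono)

text \<open>For a nonempty block of even size these are the vectors with lower median 0; one bound
  is strict and the other is not, which singles out the lower of the two middle entries.\<close>

definition central :: "'i set \<Rightarrow> ('i \<Rightarrow> int) set" where
  "central B = {z\<in>int_vecs B. npos B z \<le> card B div 2 \<and> nneg B z < card B div 2}"

text \<open>With \<open>2 k\<close> coordinates, having more than \<open>k\<close> positive and
  having at least \<open>k\<close> negative ones exclude each other. So the complement of
  \<open>central B\<close> is a disjoint union of two sets with known series.\<close>

lemma gf_central:
  assumes "finite B" "card B = 2 * k"
  shows "gf (central B) (l1 B) = inverse (1 - fps_X) ^ (2 * k) *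
     (binom_trunc (2 * k) (Suc k) fps_X + binom_trunc (2 * k) k fps_X - (1 + fps_X) ^ (2 * k))"
proof -
  let ?P = "{z\<in>int_vecs B. Suc k \<le> npos B z}" and ?N = "{z\<in>int_vecs B. k \<le> nneg B z}"
  have le: "npos B z + nneg B z \<le> 2 * k" for z
    using npos_nneg_le[OF assms(1), of z] assms(2) by simp
  have "False" if "Suc k \<le> npos B z" "k \<le> nneg B z" for z
    using le[of z] that by linarith
  then have dj: "central B \<inter> (?P \<union> ?N) = {}" "?P \<inter> ?N = {}"
    by (auto simp: central_def assms(2))
  have un: "int_vecs B = central B \<union> (?P \<union> ?N)"
    by (auto simp: central_def assms(2))
  have fl: "finite_levels (central B) (l1 B)" "finite_levels ?P (l1 B)" "finite_levels ?N (l1 B)"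
    "finite_levels (?P \<union> ?N) (l1 B)"
    by (rule finite_levels_l1[OF assms(1)], auto simp: central_def)+
  have "gf (int_vecs B) (l1 B) = gf (central B) (l1 B) + (gf ?P (l1 B) + gf ?N (l1 B))"
    by (subst un) (simp only: gf_Un[OF fl(1,4) dj(1)] gf_Un[OF fl(2,3) dj(2)])
  moreover have "gf ?P (l1 B) = inverse (1 - fps_X) ^ (2 * k) * ((1 + fps_X) ^ (2 * k) - binom_trunc (2 * k) (Suc k) fps_X)"
    using gf_npos_ge[OF assms(1), of "Suc k"] assms(2) by simp
  moreover have "gf ?N (l1 B) = inverse (1 - fps_X) ^ (2 * k) * ((1 + fps_X) ^ (2 * k) - binom_trunc (2 * k) k fps_X)"
    unfolding gf_nneg_ge using gf_npos_ge[OF assms(1), of k] assms(2) by simp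
  ultimately show ?thesis
    by (simp add: gf_l1[OF assms(1)] assms(2) algebra_simps)
qed

section \<open>Medians and the gauge of a block\<close>

lemma card_filter_add: "finite B \<Longrightarrow> card {i\<in>B. Q i} + card {i\<in>B. \<not> Q i} = card B"
  by (subst card_Un_disjoint[symmetric]) (auto intro!: arg_cong[where f = card])

lemma sum_if_sign:
  fixes e :: real
  assumes "finite B"
  shows "(\<Sum>i\<in>B. if Q i then - e else e) = e * (real (card B) - 2 * real (card {i\<in>B. Q i}))"
proof -
  have "real (card B) = real (card {i\<in>B. Q i}) + real (card {i\<in>B. \<not> Q i})"
    unfolding card_filter_add[OF assms, of Q, symmetric] by simp
  moreover have "B \<inter> {i. Q i} = {i\<in>B. Q i}" "B \<inter> - {i. Q i} = {i\<in>B. \<not> Q i}" by auto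
  ultimately show ?thesis using assms by (simp add: sum.If_cases algebra_simps)
qed

text \<open>Entries up to \<open>c\<close> move away by \<open>c' - c\<close>, the others come
  nearer by at most that much, and the former are at least half of all.\<close>

lemma sum_abs_shift_up:
  fixes z :: "'i \<Rightarrow> real"
  assumes "finite B" "2 * card {i\<in>B. c < z i} \<le> card B" "c \<le> c'"
  shows "(\<Sum>i\<in>B. \<bar>z i - c\<bar>) \<le> (\<Sum>i\<in>B. \<bar>z i - c'\<bar>)"
proof -
  have "0 \<le> (c' - c) * (real (card B) - 2 * real (card {i\<in>B. c < z i}))"
    using assms(2,3) by (intro mult_nonneg_nonneg) linarith+
  then have "(\<Sum>i\<in>B. \<bar>z i - c\<bar>) \<le> (\<Sum>i\<in>B. \<bar>z i - c\<bar> + (if c < z i then - (c' - c) else c' - c))"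
    unfolding sum.distrib sum_if_sign[OF assms(1)] by linarith
  also have "\<dots> \<le> (\<Sum>i\<in>B. \<bar>z i - c'\<bar>)"
    using assms(3) by (intro sum_mono) auto
  finally show ?thesis .
qed

text \<open>At least two more entries get farther away than come nearer, so the sum grows at rate at
  least 2.\<close>

lemma sum_abs_shift_down:
  fixes z :: "'i \<Rightarrow> real"
  assumes "finite B" "2 * card {i\<in>B. z i < c} + 2 \<le> card B" "c' \<le> c"
  shows "(\<Sum>i\<in>B. \<bar>z i - c\<bar>) + 2 * (c - c') \<le> (\<Sum>i\<in>B. \<bar>z i - c'\<bar>)"
proof -
  have "(c - c') * 2 \<le> (c - c') * (real (card B) - 2 * real (card {i\<in>B. z i < c}))"
    using assms(2,3) by (intro mult_left_mono) linarith+
  then have "(\<Sum>i\<in>B. \<bar>z i - c\<bar>) + 2 * (c - c') \<le>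
      (\<Sum>i\<in>B. \<bar>z i - c\<bar> + (if z i < c then - (c - c') else c - c'))"
    unfolding sum.distrib sum_if_sign[OF assms(1)] by linarith
  also have "\<dots> \<le> (\<Sum>i\<in>B. \<bar>z i - c'\<bar>)"
    using assms(3) by (intro sum_mono) auto
  finally show ?thesis .
qed

lemma real_l1: "real (l1 B (\<lambda>i. z i - c)) = (\<Sum>i\<in>B. \<bar>real_of_int (z i) - real_of_int c\<bar>)"
  unfolding l1_def by (simp flip: of_int_diff of_int_abs)

text \<open>The optimal multiple of the all-ones vector to split off \<open>z\<close>: its lower median,
  truncated at 0.\<close>
definition med :: "'i set \<Rightarrow> ('i \<Rightarrow> int) \<Rightarrow> nat" where
  "med B z = (LEAST c. 2 * card {i\<in>B. int c < z i} \<le> card B)"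

text \<open>For even \<open>card B\<close> this is the minimum of
  \<open>c + (\<Sum>i\<in>B. \<bar>z i - c\<bar>)\<close> over real \<open>c \<ge> 0\<close>, by
  \<open>gauge1_le\<close> and \<open>gauge1_attained\<close>: the gauge of the hull of the unit
  vectors, their negatives and the all-ones vector.\<close>

definition gauge1 :: "'i set \<Rightarrow> ('i \<Rightarrow> int) \<Rightarrow> nat" where
  "gauge1 B z = med B z + l1 B (\<lambda>i. z i - int (med B z))"

text \<open>Here the negative of the all-ones vector is a generator too, so negative multiples
  compete as well; \<open>neg_on\<close> reduces them to \<open>gauge1\<close>.\<close>

definition gauge2 :: "'i set \<Rightarrow> ('i \<Rightarrow> int) \<Rightarrow> nat" where
  "gauge2 B z = (if 2 * nneg B z \<le> card B then gauge1 B z else gauge1 B (neg_on B z))"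

lemma med_le:
  assumes "finite B"
  shows "2 * card {i\<in>B. int (med B z) < z i} \<le> card B"
  unfolding med_def
proof (rule LeastI)
  \<comment> \<open>A bound on all entries witnesses that the \<open>LEAST\<close> in
    \<open>med\<close> ranges over a nonempty set.\<close>
  have "z i \<le> int (l1 B z)" if "i \<in> B" for i
    using member_le_sum[OF that, of "\<lambda>i. nat \<bar>z i\<bar>"] assms unfolding l1_def by linarith
  then have "{i\<in>B. int (l1 B z) < z i} = {}" by (auto simp: not_less)
  then show "2 * card {i\<in>B. int (l1 B z) < z i} \<le> card B" by (metis card.empty mult_0_right le0)
qed

text \<open>By minimality, more than half of the entries exceed \<open>med B z - 1\<close>, so fewer
  than half lie below the median; parity turns this strict inequality into a gap of 2.\<close>

lemma med_gt:
  assumes "finite B" "even (card B)" "0 < med B z"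
  shows "2 * card {i\<in>B. z i < int (med B z)} + 2 \<le> card B"
proof -
  obtain c where c: "med B z = Suc c" using assms(3) gr0_implies_Suc by blast
  have "\<not> 2 * card {i\<in>B. int c < z i} \<le> card B"
    using not_less_Least[of c "\<lambda>c. 2 * card {i\<in>B. int c < z i} \<le> card B"] c
    unfolding med_def by simp
  moreover have "{i\<in>B. \<not> int c < z i} = {i\<in>B. z i < int (med B z)}"
    using c by auto
  ultimately have "2 * card {i\<in>B. z i < int (med B z)} < card B"
    using card_filter_add[OF assms(1), of "\<lambda>i. int c < z i"] by simp
  then show ?thesis using assms(2) by presburger
qed

lemma med_eq_0_iff: "finite B \<Longrightarrow> med B z = 0 \<longleftrightarrow> 2 * npos B z \<le> card B"
  using med_le[of B z] Least_le[of "\<lambda>c. 2 * card {i\<in>B. int c < z i} \<le> card B" 0]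
  by (auto simp: npos_def med_def)

text \<open>To the right of the median the sum of distances does not shrink; to the left it grows at
  rate at least 2, which outweighs the saving in \<open>c\<close>.\<close>

lemma gauge1_le:
  fixes c :: real
  assumes "finite B" "even (card B)" "0 \<le> c"
  shows "real (gauge1 B z) \<le> c + (\<Sum>i\<in>B. \<bar>of_int (z i) - c\<bar>)"
proof (cases "real (med B z) \<le> c")
  case True
  have "{i\<in>B. real (med B z) < of_int (z i)} = {i\<in>B. int (med B z) < z i}" by auto
  then have "(\<Sum>i\<in>B. \<bar>of_int (z i) - real (med B z)\<bar>) \<le> (\<Sum>i\<in>B. \<bar>of_int (z i) - c\<bar>)"
    using med_le[OF assms(1), of z] by (intro sum_abs_shift_up[OF assms(1) _ True]) simp
  then show ?thesis using True unfolding gauge1_def of_nat_add real_l1 by simp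
next
  case False
  then have "0 < med B z" using assms(3) by auto
  have "{i\<in>B. of_int (z i) < real (med B z)} = {i\<in>B. z i < int (med B z)}" by auto
  then have "(\<Sum>i\<in>B. \<bar>of_int (z i) - real (med B z)\<bar>) + 2 * (real (med B z) - c)
      \<le> (\<Sum>i\<in>B. \<bar>of_int (z i) - c\<bar>)"
    using med_gt[OF assms(1,2) \<open>0 < med B z\<close>] False by (intro sum_abs_shift_down[OF assms(1)]) auto
  then show ?thesis using False unfolding gauge1_def of_nat_add real_l1 by simp
qed

lemma gauge1_attained:
  "\<exists>c::int. 0 \<le> c \<and> real (gauge1 B z) = of_int c + (\<Sum>i\<in>B. \<bar>of_int (z i) - of_int c\<bar>)"
  by (rule exI[of _ "int (med B z)"]) (simp add: gauge1_def real_l1)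

text \<open>When at most half of the entries are negative, reflecting shows that 0 is at least as
  good as any negative \<open>c\<close>.\<close>

lemma gauge1_le_abs:
  fixes c :: real
  assumes "finite B" "even (card B)" "2 * nneg B z \<le> card B"
  shows "real (gauge1 B z) \<le> \<bar>c\<bar> + (\<Sum>i\<in>B. \<bar>of_int (z i) - c\<bar>)"
proof (cases "0 \<le> c")
  case True
  then show ?thesis using gauge1_le[OF assms(1,2) True] by simp
next
  case False
  have "{i\<in>B. 0 < - real_of_int (z i)} = {i\<in>B. z i < 0}" by auto
  then have "(\<Sum>i\<in>B. \<bar>- of_int (z i) - (0::real)\<bar>) \<le> (\<Sum>i\<in>B. \<bar>- of_int (z i) - (- c)\<bar>)"
    using assms(3) False by (intro sum_abs_shift_up[OF assms(1)]) (auto simp: nneg_def)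
  moreover have "\<bar>- of_int (z i) - (- c)\<bar> = \<bar>of_int (z i) - c\<bar>" for i by linarith
  moreover have "real (gauge1 B z) \<le> (\<Sum>i\<in>B. \<bar>of_int (z i)\<bar>)"
    using gauge1_le[OF assms(1,2), of 0 z] by simp
  ultimately show ?thesis by simp
qed

lemma gauge2_le:
  fixes c :: real
  assumes "finite B" "even (card B)"
  shows "real (gauge2 B z) \<le> \<bar>c\<bar> + (\<Sum>i\<in>B. \<bar>of_int (z i) - c\<bar>)"
proof (cases "2 * nneg B z \<le> card B")
  case True
  then show ?thesis using gauge1_le_abs[OF assms True] by (simp add: gauge2_def)
next
  case False
  then have "2 * nneg B (neg_on B z) \<le> card B"
    using npos_nneg_le[OF assms(1), of z] by simp
  from gauge1_le_abs[OF assms this, of "- c"]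
  have "real (gauge2 B z) \<le> \<bar>c\<bar> + (\<Sum>i\<in>B. \<bar>of_int (neg_on B z i) + c\<bar>)"
    using False by (simp add: gauge2_def)
  also have "(\<Sum>i\<in>B. \<bar>of_int (neg_on B z i) + c\<bar>) = (\<Sum>i\<in>B. \<bar>of_int (z i) - c\<bar>)"
    by (intro sum.cong refl) (auto simp: neg_on_def)
  finally show ?thesis .
qed

lemma gauge2_attained:
  "\<exists>c::int. real (gauge2 B z) = \<bar>of_int c\<bar> + (\<Sum>i\<in>B. \<bar>of_int (z i) - of_int c\<bar>)"
proof (cases "2 * nneg B z \<le> card B")
  case True
  then show ?thesis using gauge1_attained[of B z] by (metis abs_of_nonneg gauge2_def of_int_0_le_iff)
next
  case False
  obtain c :: int where "0 \<le> c" "real (gauge1 B (neg_on B z)) =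
      of_int c + (\<Sum>i\<in>B. \<bar>of_int (neg_on B z i) - of_int c\<bar>)"
    using gauge1_attained by blast
  moreover have "(\<Sum>i\<in>B. \<bar>of_int (neg_on B z i) - real_of_int c\<bar>) = (\<Sum>i\<in>B. \<bar>of_int (z i) - of_int (- c)\<bar>)"
    by (intro sum.cong refl) (auto simp: neg_on_def)
  ultimately show ?thesis using False by (intro exI[of _ "- c"]) (auto simp: gauge2_def)
qed

section \<open>Generating functions of the block gauges\<close>

text \<open>Subtracting the median, which is at least 1 exactly when more than half of the entries
  are positive, leaves a central vector. The decomposition is unique and \<open>gauge1\<close> is
  additive along it.\<close>

lemma bij_betw_shift:
  assumes "finite B" "even (card B)"
  shows "bij_betw (\<lambda>(c, y). \<lambda>i\<in>B. y i + c) ({1..} \<times> central B) {z\<in>int_vecs B. card B < 2 * npos B z}"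
    and "\<And>c y. 1 \<le> c \<Longrightarrow> y \<in> central B \<Longrightarrow> gauge1 B (\<lambda>i\<in>B. y i + c) = nat c + l1 B y"
proof -
  have med: "med B (\<lambda>i\<in>B. y i + c) = nat c" if "1 \<le> c" "y \<in> central B" for c y
    unfolding med_def
  proof (rule Least_equality)
    have "{i\<in>B. int (nat c) < (\<lambda>i\<in>B. y i + c) i} = {i\<in>B. 0 < y i}" using that(1) by auto
    then show "2 * card {i\<in>B. int (nat c) < (\<lambda>i\<in>B. y i + c) i} \<le> card B"
      using that(2) by (auto simp: central_def npos_def)
  next
    fix d assume d: "2 * card {i\<in>B. int d < (\<lambda>i\<in>B. y i + c) i} \<le> card B"
    show "nat c \<le> d"
    proof (rule ccontr)
      assume "\<not> nat c \<le> d"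
      \<comment> \<open>For \<open>d < c\<close> every entry with \<open>y i \<ge> 0\<close> exceeds
        \<open>d\<close> after the shift, and these are more than half.\<close>
      then have "{i\<in>B. \<not> y i < 0} \<subseteq> {i\<in>B. int d < (\<lambda>i\<in>B. y i + c) i}" by auto
      then have "card {i\<in>B. \<not> y i < 0} \<le> card {i\<in>B. int d < (\<lambda>i\<in>B. y i + c) i}"
        using assms(1) by (intro card_mono) auto
      moreover have "card {i\<in>B. \<not> y i < 0} + nneg B y = card B"
        using card_filter_add[OF assms(1), of "\<lambda>i. y i < 0"] by (simp add: nneg_def)
      moreover have "nneg B y < card B div 2" using that(2) by (simp add: central_def)
      ultimately show False using d assms(2) by presburger
    qed
  qed
  show g: "gauge1 B (\<lambda>i\<in>B. y i + c) = nat c + l1 B y" if "1 \<le> c" "y \<in> central B" for c y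
    using that(1) unfolding gauge1_def med[OF that] l1_def by simp
  show "bij_betw (\<lambda>(c, y). \<lambda>i\<in>B. y i + c) ({1..} \<times> central B) {z\<in>int_vecs B. card B < 2 * npos B z}"
  proof (rule bij_betw_byWitness[where f' = "\<lambda>z. (int (med B z), \<lambda>i\<in>B. z i - int (med B z))"], goal_cases)
    case 1
    show ?case
      using med by (auto simp: central_def fun_eq_iff PiE_def extensional_def)
  next
    case 2
    show ?case by (auto simp: fun_eq_iff PiE_def extensional_def)
  next
    case 3
    have "card B < 2 * npos B (\<lambda>i\<in>B. y i + c)" if "1 \<le> c" "y \<in> central B" for c y
      using med_eq_0_iff[OF assms(1), of "\<lambda>i\<in>B. y i + c"] med[OF that] that by auto
    then show ?case by auto
  next
    case 4
    have "(\<lambda>i\<in>B. z i - int (med B z)) \<in> central B \<and> 1 \<le> int (med B z)"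
      if "card B < 2 * npos B z" for z
    proof -
      have m: "0 < med B z" using med_eq_0_iff[OF assms(1), of z] that by simp
      have "{i\<in>B. 0 < (\<lambda>i\<in>B. z i - int (med B z)) i} = {i\<in>B. int (med B z) < z i}"
        "{i\<in>B. (\<lambda>i\<in>B. z i - int (med B z)) i < 0} = {i\<in>B. z i < int (med B z)}" by auto
      then have "npos B (\<lambda>i\<in>B. z i - int (med B z)) = card {i\<in>B. int (med B z) < z i}"
        "nneg B (\<lambda>i\<in>B. z i - int (med B z)) = card {i\<in>B. z i < int (med B z)}"
        by (simp_all only: npos_def nneg_def)
      then show ?thesis
        using med_le[OF assms(1), of z] med_gt[OF assms m] m assms(2)
        by (auto simp: central_def elim!: evenE)
    qed
    then show ?case by auto
  qed
qed

text \<open>The gauges can differ from \<open>l1\<close> only on vectors with more than half of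
  their entries positive, or for \<open>gauge2\<close> also on those with more than half negative.
  There the shift bijection yields the correction \<open>D\<close>, once for \<open>gauge1\<close>
  and twice for \<open>gauge2\<close>.\<close>

lemma
  assumes "finite B" "card B = 2 * k"
  shows finite_levels_gauge1: "X \<subseteq> int_vecs B \<Longrightarrow> finite_levels X (gauge1 B)"
    and gf_gauge1: "(1 - fps_X) ^ (2 * k) * gf (int_vecs B) (gauge1 B) =
      fps_of_poly ([:1, 1:] ^ (2 * k) + block_poly k)"
    and finite_levels_gauge2: "finite_levels (int_vecs B) (gauge2 B)"
    and gf_gauge2: "(1 - fps_X) ^ (2 * k) * gf (int_vecs B) (gauge2 B) =
      fps_of_poly ([:1, 1:] ^ (2 * k) + smult 2 (block_poly k))"
proof -
  define q :: "real fps" where "q = inverse (1 - fps_X)"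
  have q: "(1 - fps_X) * q = 1"
    unfolding q_def by (rule inverse_mult_eq_1') simp
  have qn: "(1 - fps_X) ^ (2 * k) * q ^ (2 * k) = 1"
    using q by (simp flip: power_mult_distrib)
  let ?P = "{z\<in>int_vecs B. card B < 2 * npos B z}" and ?P' = "{z\<in>int_vecs B. 2 * npos B z \<le> card B}"
  let ?N = "{z\<in>int_vecs B. card B < 2 * nneg B z}" and ?N' = "{z\<in>int_vecs B. 2 * nneg B z \<le> card B}"
  have ev: "even (card B)" using assms(2) by simp
  have unP: "int_vecs B = ?P \<union> ?P'" and djP: "?P \<inter> ?P' = {}"
    and unN: "int_vecs B = ?N \<union> ?N'" and djN: "?N \<inter> ?N' = {}" by auto
  have flc: "finite_levels (central B) (l1 B)"
    by (rule finite_levels_l1[OF assms(1)]) (auto simp: central_def)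
  have gsh: "gauge1 B ((\<lambda>(c, y). \<lambda>i\<in>B. y i + c) p) = (\<lambda>(c, y). nat c + l1 B y) p"
    if "p \<in> {1..} \<times> central B" for p
    using that bij_betw_shift(2)[OF assms(1) ev] by auto
  have flP: "finite_levels ?P (gauge1 B)"
    using finite_levels_reindex[OF bij_betw_shift(1)[OF assms(1) ev],
        of "gauge1 B" "\<lambda>(c, y). nat c + l1 B y", OF gsh]
      finite_levels_Times[OF finite_levels_pos flc] by simp
  have A: "gf ?P (gauge1 B) = fps_X * q * gf (central B) (l1 B)"
    using gf_reindex[OF bij_betw_shift(1)[OF assms(1) ev],
        of "gauge1 B" "\<lambda>(c, y). nat c + l1 B y", OF gsh]
      gf_Times[OF finite_levels_pos flc] by (simp add: gf_pos q_def)
  have l1: "gauge1 B z = l1 B z" if "2 * npos B z \<le> card B" for z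
    using that med_eq_0_iff[OF assms(1), of z] by (simp add: gauge1_def)
  have fl1: "finite_levels X (l1 B)" if "X \<subseteq> int_vecs B" for X
    by (rule finite_levels_l1[OF assms(1) that])
  have cl1: "gf X (gauge1 B) = gf X (l1 B)" "finite_levels X (gauge1 B) = finite_levels X (l1 B)"
    if "X \<subseteq> ?P'" for X
    using that l1 by (auto intro!: gf_cong finite_levels_reindex[of id] simp: id_def bij_betw_def)
  have "finite_levels (int_vecs B) (gauge1 B)"
    unfolding finite_levels_def
  proof
    fix m
    have "{x\<in>int_vecs B. gauge1 B x = m} = {x\<in>?P. gauge1 B x = m} \<union> {x\<in>?P'. gauge1 B x = m}"
      by auto
    then show "finite {x\<in>int_vecs B. gauge1 B x = m}"
      using flP cl1(2)[of ?P'] fl1[of ?P'] by (auto simp: finite_levels_def)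
  qed
  then show fl: "finite_levels X (gauge1 B)" if "X \<subseteq> int_vecs B" for X
    using that finite_levels_subset by blast
  have P': "gf ?P' (l1 B) + gf ?P (l1 B) = gf (int_vecs B) (l1 B)"
    by (subst (3) unP) (subst gf_Un, auto intro!: fl1)
  have PB: "gf ?P (l1 B) = q ^ (2 * k) * ((1 + fps_X) ^ (2 * k) - binom_trunc (2 * k) (Suc k) fps_X)"
  proof -
    have "?P = {z\<in>int_vecs B. Suc k \<le> npos B z}" using assms(2) by auto
    then show ?thesis using gf_npos_ge[OF assms(1), of "Suc k"] assms(2) by (simp add: q_def)
  qed
  define D where "D = gf ?P (gauge1 B) - gf ?P (l1 B)"
  have all: "(1 - fps_X) ^ (2 * k) * gf (int_vecs B) (l1 B) = (1 + fps_X) ^ (2 * k)"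
    unfolding gf_l1[OF assms(1)] assms(2) q_def[symmetric] using qn by (simp add: algebra_simps)
  have D: "(1 - fps_X) ^ (2 * k) * D = fps_of_poly (block_poly k)"
  proof -
    let ?X = "fps_X :: real fps" and ?T = "\<lambda>n m. binom_trunc n m (fps_X :: real fps)"
    define T0 T1 E where "T0 = ?T (2 * k) k" and "T1 = ?T (2 * k) (Suc k)" and "E = (1 + ?X) ^ (2 * k)"
    have D0: "D = q ^ (2 * k) * (?X * q * (T1 + T0 - E) - (E - T1))"
      unfolding D_def A PB gf_central[OF assms] q_def[symmetric] T0_def T1_def E_def
      by (simp add: algebra_simps)
    \<comment> \<open>Another factor \<open>1 - fps_X\<close> clears the \<open>q\<close> that
      counts the shifts \<open>c \<ge> 1\<close>; being nonzero, it is cancelled at the end.\<close>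
    have "(1 - ?X) * ((1 - ?X) ^ (2 * k) * D) =
       ((1 - ?X) ^ (2 * k) * q ^ (2 * k)) * (?X * ((1 - ?X) * q) * (T1 + T0 - E) - (1 - ?X) * (E - T1))"
      unfolding D0 by (simp only: algebra_simps)
    also have "\<dots> = ?X * (T1 + T0 - E) - (1 - ?X) * (E - T1)"
      unfolding qn q by simp
    also have "\<dots> = (?X * T0 + T1) - E" by (simp add: algebra_simps)
    also have "\<dots> = (1 - ?X) * fps_of_poly (block_poly k)"
      unfolding block_poly_eq T0_def T1_def E_def binom_trunc_pascal ..
    finally show ?thesis
      by (metis mult_left_cancel mult_zero_left q zero_neq_one)
  qed
  have g1: "gf (int_vecs B) (gauge1 B) = gf (int_vecs B) (l1 B) + D"
  proof -
    have "gf (int_vecs B) (gauge1 B) = gf ?P (gauge1 B) + gf ?P' (gauge1 B)"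
      by (subst unP) (rule gf_Un[OF flP fl djP], auto)
    then show ?thesis using cl1(1)[of ?P'] P' by (simp add: D_def algebra_simps)
  qed
  show "(1 - fps_X) ^ (2 * k) * gf (int_vecs B) (gauge1 B) = fps_of_poly ([:1, 1:] ^ (2 * k) + block_poly k)"
    unfolding g1 distrib_left D all fps_of_poly_add fps_of_poly_linear_power ..
  have bN: "bij_betw (neg_on B) ?N ?P"
    using bij_betw_neg_on[of B "\<lambda>z. card B < 2 * npos B z"] by simp
  have c2: "gf ?N' (gauge2 B) = gf ?N' (gauge1 B)" by (rule gf_cong) (simp add: gauge2_def)
  have r2: "gauge1 B (neg_on B z) = gauge2 B z" if "z \<in> ?N" for z
    using that by (simp add: gauge2_def)
  have n2: "gf ?N (gauge2 B) = gf ?P (gauge1 B)" by (rule gf_reindex[OF bN, of "gauge1 B" "gauge2 B", OF r2])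
  have fN: "finite_levels ?N (gauge2 B)" using finite_levels_reindex[OF bN, of "gauge1 B" "gauge2 B", OF r2] flP by blast
  have fN': "finite_levels ?N' (gauge2 B)"
    using finite_levels_reindex[of id ?N' ?N' "gauge2 B" "gauge1 B"] fl[of ?N'] by (auto simp: gauge2_def)
  show "finite_levels (int_vecs B) (gauge2 B)"
    unfolding finite_levels_def
  proof
    fix m
    have "{x\<in>int_vecs B. gauge2 B x = m} = {x\<in>?N. gauge2 B x = m} \<union> {x\<in>?N'. gauge2 B x = m}"
      by auto
    then show "finite {x\<in>int_vecs B. gauge2 B x = m}"
      using fN fN' by (simp add: finite_levels_def)
  qed
  \<comment> \<open>More than half negative entries leave fewer than half positive, so
    \<open>gauge1\<close> is \<open>l1\<close> here, and \<open>neg_on\<close> carries the set to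
    \<open>?P\<close>.\<close>
  have N1: "gf ?N (gauge1 B) = gf ?P (l1 B)"
  proof -
    have "2 * npos B z \<le> card B" if "card B < 2 * nneg B z" for z
      using npos_nneg_le[OF assms(1), of z] that by linarith
    then have "?N \<subseteq> ?P'" by auto
    then have "gf ?N (gauge1 B) = gf ?N (l1 B)" by (rule cl1(1))
    also have "\<dots> = gf ?P (l1 B)" by (rule gf_reindex[OF bN]) simp
    finally show ?thesis .
  qed
  have "gf (int_vecs B) (gauge2 B) = gf ?N (gauge2 B) + gf ?N' (gauge2 B)"
    by (subst unN) (rule gf_Un[OF fN fN' djN])
  moreover have "gf (int_vecs B) (gauge1 B) = gf ?N (gauge1 B) + gf ?N' (gauge1 B)"
    by (subst unN) (rule gf_Un[OF fl fl djN], auto)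
  ultimately have "gf (int_vecs B) (gauge2 B) = gf (int_vecs B) (l1 B) + 2 * D"
    using g1 c2 n2 N1 by (simp add: D_def algebra_simps)
  then show "(1 - fps_X) ^ (2 * k) * gf (int_vecs B) (gauge2 B) =
      fps_of_poly ([:1, 1:] ^ (2 * k) + smult 2 (block_poly k))"
    using D all by (simp add: distrib_left fps_of_poly_add fps_of_poly_smult fps_of_poly_linear_power
        mult.left_commute[of _ 2] numeral_fps_const)
qed

section \<open>Cones of gamma-positive polynomials\<close>

text \<open>\<open>d\<close> is a parameter in place of \<open>degree f\<close>: for fixed
  \<open>d\<close> this gives a convex cone containing 0, and under products the parameters
  add.\<close>

definition gamma_nonneg :: "nat \<Rightarrow> real poly \<Rightarrow> bool" where
  "gamma_nonneg d f \<longleftrightarrow> (\<exists>\<gamma> :: nat \<Rightarrow> real. (\<forall>i. \<gamma> i \<ge> 0) \<and>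
    f = (\<Sum>i\<le>d div 2. smult (\<gamma> i) (monom 1 i * [:1, 1:] ^ (d - 2 * i))))"

lemma gamma_nonneg_0: "gamma_nonneg d 0"
  unfolding gamma_nonneg_def by (intro exI[of _ "\<lambda>_. 0"]) simp

lemma gamma_nonneg_add:
  assumes "gamma_nonneg d f" "gamma_nonneg d g"
  shows "gamma_nonneg d (f + g)"
proof -
  obtain \<gamma> \<delta> where "\<forall>i. 0 \<le> \<gamma> i" "f = (\<Sum>i\<le>d div 2. smult (\<gamma> i) (monom 1 i * [:1, 1:] ^ (d - 2 * i)))"
    "\<forall>i. 0 \<le> \<delta> i" "g = (\<Sum>i\<le>d div 2. smult (\<delta> i) (monom 1 i * [:1, 1:] ^ (d - 2 * i)))"
    using assms unfolding gamma_nonneg_def by blast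
  then show ?thesis unfolding gamma_nonneg_def
    by (intro exI[of _ "\<lambda>i. \<gamma> i + \<delta> i"]) (simp add: smult_add_left sum.distrib)
qed

lemma gamma_nonneg_smult:
  assumes "gamma_nonneg d f" "0 \<le> a"
  shows "gamma_nonneg d (smult a f)"
proof -
  obtain \<gamma> where "\<forall>i. 0 \<le> \<gamma> i" "f = (\<Sum>i\<le>d div 2. smult (\<gamma> i) (monom 1 i * [:1, 1:] ^ (d - 2 * i)))"
    using assms unfolding gamma_nonneg_def by blast
  then show ?thesis unfolding gamma_nonneg_def using assms(2)
    by (intro exI[of _ "\<lambda>i. a * \<gamma> i"]) (simp add: sum_distrib_left[of "[:a:]", simplified])
qed

lemma gamma_nonneg_sum: "(\<And>x. x \<in> A \<Longrightarrow> gamma_nonneg d (f x)) \<Longrightarrow> gamma_nonneg d (\<Sum>x\<in>A. f x)"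
  by (induction A rule: infinite_finite_induct) (simp_all add: gamma_nonneg_0 gamma_nonneg_add)

lemma gamma_nonneg_basis:
  assumes "2 * i \<le> d"
  shows "gamma_nonneg d (monom 1 i * [:1, 1:] ^ (d - 2 * i))"
  unfolding gamma_nonneg_def
proof (intro exI[of _ "\<lambda>j. if j = i then 1 else 0"] conjI allI)
  have "i \<le> d div 2" using assms by simp
  then show "monom 1 i * [:1, 1:] ^ (d - 2 * i) =
      (\<Sum>j\<le>d div 2. smult (if j = i then 1 else 0) (monom (1::real) j * [:1, 1:] ^ (d - 2 * j)))"
    by (simp add: if_distrib[of "\<lambda>a. smult a _"] cong: if_cong)
qed simp

text \<open>Basis elements multiply to basis elements, with indices and degrees added.\<close>

lemma gamma_nonneg_mult:
  assumes "gamma_nonneg d f" "gamma_nonneg e g"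
  shows "gamma_nonneg (d + e) (f * g)"
proof -
  obtain \<gamma> \<delta> where *: "\<And>i. 0 \<le> \<gamma> i" "f = (\<Sum>i\<le>d div 2. smult (\<gamma> i) (monom 1 i * [:1, 1:] ^ (d - 2 * i)))"
    "\<And>i. 0 \<le> \<delta> i" "g = (\<Sum>i\<le>e div 2. smult (\<delta> i) (monom 1 i * [:1, 1:] ^ (e - 2 * i)))"
    using assms unfolding gamma_nonneg_def by blast
  have basis: "(monom 1 i * [:1, 1:] ^ (d - 2 * i)) * (monom 1 j * [:1, 1:] ^ (e - 2 * j)) =
      monom (1::real) (i + j) * [:1, 1:] ^ (d + e - 2 * (i + j))" if "i \<le> d div 2" "j \<le> e div 2" for i j
  proof -
    have "2 * i \<le> d" "2 * j \<le> e" using that by auto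
    then have "d + e - 2 * (i + j) = (d - 2 * i) + (e - 2 * j)" by simp
    moreover have "monom (1::real) (i + j) = monom 1 i * monom 1 j" by (simp add: mult_monom)
    ultimately show ?thesis by (simp only: power_add mult_ac)
  qed
  have "f * g = (\<Sum>i\<le>d div 2. \<Sum>j\<le>e div 2. smult (\<gamma> i * \<delta> j)
      ((monom 1 i * [:1, 1:] ^ (d - 2 * i)) * (monom 1 j * [:1, 1:] ^ (e - 2 * j))))"
    unfolding *(2,4) sum_product
    by (intro sum.cong refl) (simp only: mult_smult_left mult_smult_right smult_smult mult.commute)
  also have "\<dots> = (\<Sum>i\<le>d div 2. \<Sum>j\<le>e div 2. smult (\<gamma> i * \<delta> j)
      (monom 1 (i + j) * [:1, 1:] ^ (d + e - 2 * (i + j))))"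
    by (intro sum.cong refl) (simp only: basis atMost_iff)
  also have "gamma_nonneg (d + e) \<dots>"
    using *(1,3) by (intro gamma_nonneg_sum gamma_nonneg_smult gamma_nonneg_basis) auto
  finally show ?thesis .
qed

lemma gamma_nonneg_linear_power: "gamma_nonneg d ([:1, 1:] ^ d)"
  using gamma_nonneg_basis[of 0 d] by simp

lemma gamma_nonneg_prod:
  assumes "\<And>x. x \<in> A \<Longrightarrow> gamma_nonneg (d x) (f x)"
  shows "gamma_nonneg (\<Sum>x\<in>A. d x) (\<Prod>x\<in>A. f x)"
  using assms
  by (induction A rule: infinite_finite_induct)
    (simp_all add: gamma_nonneg_mult gamma_nonneg_linear_power[of 0, simplified])

lemma gamma_nonneg_block_poly: "gamma_nonneg (2 * k) (block_poly k)"
proof (induction k)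
  case 0
  then show ?case by (simp add: gamma_nonneg_0)
next
  case (Suc k)
  \<comment> \<open>The monomial is a multiple of the last basis element for
    \<open>2 * Suc k\<close>, the one with exponent 0 at \<open>[:1, 1:]\<close>.\<close>
  have "monom (of_nat (Suc (2 * k) choose k)) (Suc k) =
      smult (of_nat (Suc (2 * k) choose k)) (monom (1::real) (Suc k) * [:1, 1:] ^ (2 * Suc k - 2 * Suc k))"
    by (simp add: smult_monom)
  then have "gamma_nonneg (2 * Suc k) (monom (of_nat (Suc (2 * k) choose k)) (Suc k))"
    by (metis gamma_nonneg_smult gamma_nonneg_basis order.refl of_nat_0_le_iff)
  moreover have "gamma_nonneg (2 * Suc k) ([:1, 1:] ^ 2 * block_poly k)"
    using gamma_nonneg_mult[OF gamma_nonneg_linear_power[of 2] Suc.IH] by simp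
  ultimately show ?case unfolding block_poly.simps by (rule gamma_nonneg_add[rotated])
qed

text \<open>Only the basis element with index 0 contributes to the coefficients at 0 and at
  \<open>d\<close>, and equally to both. A nonzero constant term thus forces
  \<open>degree f = d\<close>; the symmetry holds for each basis element.\<close>

lemma gamma_positiveI:
  assumes "gamma_nonneg d f" "coeff f 0 \<noteq> 0"
  shows "gamma_positive f"
proof -
  obtain \<gamma> where \<gamma>: "\<And>i. 0 \<le> \<gamma> i"
    and f: "f = (\<Sum>i\<le>d div 2. smult (\<gamma> i) (monom 1 i * [:1, 1:] ^ (d - 2 * i)))"
    using assms unfolding gamma_nonneg_def by blast
  have c0: "coeff (monom (1::real) i * [:1, 1:] ^ (d - 2 * i)) 0 = (if i = 0 then 1 else 0)" for i
    by (simp add: coeff_monom_mult poly_monom poly_0_coeff_0[symmetric])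
  have cd: "coeff (monom (1::real) i * [:1, 1:] ^ (d - 2 * i)) d = (if i = 0 then 1 else 0)"
    if "i \<le> d div 2" for i
  proof (cases "i = 0")
    case True
    then show ?thesis by (simp add: coeff_linear_power)
  next
    case False
    have "degree ([:1, 1 :: real:] ^ (d - 2 * i)) < d - i"
      unfolding degree_linear_power using False that by linarith
    then show ?thesis using False that by (simp add: coeff_monom_mult coeff_eq_0)
  qed
  have "coeff f 0 = \<gamma> 0" by (simp add: f coeff_sum c0 if_distrib cong: if_cong)
  moreover have "coeff f d = (\<Sum>i\<le>d div 2. \<gamma> i * (if i = 0 then 1 else 0))"
    unfolding f coeff_sum coeff_smult by (intro sum.cong refl arg_cong2[where f = times] cd) simp
  ultimately have "coeff f d \<noteq> 0" using assms(2) by (simp add: if_distrib cong: if_cong)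
  moreover have "degree f \<le> d"
    unfolding f
  proof (rule degree_sum_le)
    fix i assume "i \<in> {..d div 2}"
    then show "degree (smult (\<gamma> i) (monom 1 i * [:1, 1:] ^ (d - 2 * i))) \<le> d"
      by (intro order.trans[OF degree_smult_le] order.trans[OF degree_mult_le])
        (simp add: degree_monom_eq degree_linear_power)
  qed simp
  ultimately have deg: "degree f = d" using le_degree by (metis order.antisym)
  have "poly f x = x ^ d * poly f (1 / x)" if "x \<noteq> 0" for x
  proof -
    have "x ^ i * (1 + x) ^ (d - 2 * i) = x ^ d * ((1 / x) ^ i * (1 + 1 / x) ^ (d - 2 * i))"
      if "i \<le> d div 2" for i
    proof -
      have d: "x ^ d = x ^ i * x ^ i * x ^ (d - 2 * i)"
        using that by (simp flip: power_add)
      have "x ^ (d - 2 * i) * (1 + 1 / x) ^ (d - 2 * i) = (1 + x) ^ (d - 2 * i)"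
        using \<open>x \<noteq> 0\<close> by (simp add: distrib_left add.commute flip: power_mult_distrib)
      moreover have "x ^ i * (1 / x) ^ i = 1"
        using \<open>x \<noteq> 0\<close> by (simp flip: power_mult_distrib)
      moreover have "x ^ d * ((1 / x) ^ i * (1 + 1 / x) ^ (d - 2 * i)) =
          x ^ i * (x ^ i * (1 / x) ^ i) * (x ^ (d - 2 * i) * (1 + 1 / x) ^ (d - 2 * i))"
        unfolding d by (simp only: mult_ac)
      ultimately show ?thesis by simp
    qed
    then have *: "\<gamma> i * (x ^ i * (1 + x) ^ (d - 2 * i)) = x ^ d * (\<gamma> i * ((1 / x) ^ i * (1 + 1 / x) ^ (d - 2 * i)))"
      if "i \<le> d div 2" for i using that by (simp add: mult.left_commute)
    have pf: "poly f y = (\<Sum>i\<le>d div 2. \<gamma> i * (y ^ i * (1 + y) ^ (d - 2 * i)))" for y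
      by (simp add: f poly_sum poly_monom)
    show ?thesis unfolding pf sum_distrib_left by (intro sum.cong refl *) simp
  qed
  then show ?thesis
    unfolding gamma_positive_def Let_def deg using \<gamma> f by blast
qed

section \<open>Pairs of opposite facets\<close>

lemma inner_int_lattice: "x \<in> int_lattice \<Longrightarrow> y \<in> int_lattice \<Longrightarrow> x \<bullet> y \<in> \<int>"
  by (auto simp: int_lattice_def inner_vec_def intro!: Ints_sum Ints_mult)

lemma int_lattice_diff: "x \<in> int_lattice \<Longrightarrow> y \<in> int_lattice \<Longrightarrow> x - y \<in> int_lattice"
  and int_lattice_add: "x \<in> int_lattice \<Longrightarrow> y \<in> int_lattice \<Longrightarrow> x + y \<in> int_lattice"
  and int_lattice_uminus: "x \<in> int_lattice \<Longrightarrow> - x \<in> int_lattice"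
  and int_lattice_scale: "a \<in> \<int> \<Longrightarrow> x \<in> int_lattice \<Longrightarrow> a *\<^sub>R x \<in> int_lattice"
  by (auto simp: int_lattice_def)

lemma int_lattice_sum: "(\<And>i. i \<in> A \<Longrightarrow> f i \<in> int_lattice) \<Longrightarrow> (\<Sum>i\<in>A. f i) \<in> int_lattice"
  by (auto simp: int_lattice_def sum_component intro!: Ints_sum)

lemma reflexive_polytope:
  fixes P :: "(real ^ 'n) set"
  assumes "reflexive P"
  shows "finite {x. x extreme_point_of P}" "{x. x extreme_point_of P} \<subseteq> int_lattice"
    "P = convex hull {x. x extreme_point_of P}" "convex P"
proof -
  obtain V where V: "finite V" "V \<subseteq> int_lattice" "P = convex hull V"
    using assms unfolding reflexive_def lattice_polytope_def by blast
  have sub: "{x. x extreme_point_of P} \<subseteq> V"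
    using V(3) extreme_point_of_convex_hull by blast
  show "finite {x. x extreme_point_of P}" "{x. x extreme_point_of P} \<subseteq> int_lattice"
    using sub V finite_subset by auto
  show "convex P" using V by simp
  then show "P = convex hull {x. x extreme_point_of P}"
    using V finite_imp_compact_convex_hull Krein_Milman_Minkowski by blast
qed

lemma extreme_points_le:
  assumes "reflexive P" "\<And>x. x extreme_point_of P \<Longrightarrow> y \<bullet> x \<le> 1" "x \<in> P"
  shows "y \<bullet> x \<le> 1"
proof -
  have "convex hull {x. x extreme_point_of P} \<subseteq> {x. y \<bullet> x \<le> 1}"
    using assms(2) by (intro hull_minimal convex_halfspace_le) auto
  then show ?thesis using reflexive_polytope(3)[OF assms(1)] assms(3) by blast
qed

text \<open>Reflexivity writes \<open>y\<close> as a convex combination of lattice points of the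
  dual polytope. A point of positive weight must be 1 on \<open>B\<close> as well, and
  \<open>B\<close> spans, so it equals \<open>y\<close>. The face where \<open>y\<close> is 1
  contains \<open>CARD('n)\<close> independent points, hence is a facet; being a simplex, it has no
  vertex outside \<open>B\<close>.\<close>

lemma tight_functional:
  fixes P :: "(real ^ 'n) set"
  assumes "reflexive P" "simplicial P" "\<And>x. x \<in> P \<Longrightarrow> y \<bullet> x \<le> 1"
    and B: "\<And>b. b \<in> B \<Longrightarrow> b extreme_point_of P" "\<And>b. b \<in> B \<Longrightarrow> y \<bullet> b = 1"
    and "independent B" "card B = CARD('n)"
  shows "y \<in> int_lattice" "\<And>x. x extreme_point_of P \<Longrightarrow> y \<bullet> x = 1 \<Longrightarrow> x \<in> B"
proof -
  have fB: "finite B" using assms(6) independent_imp_finite by blast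
  have BP: "B \<subseteq> P" using B(1) extreme_point_of_def by blast
  have sp: "span B = UNIV"
    using card_eq_dim[of B UNIV] fB assms(6,7) by (auto simp: dim_UNIV)
  obtain V where V: "finite V" "V \<subseteq> int_lattice" "dual_polytope P = convex hull V"
    using assms(1) unfolding reflexive_def lattice_polytope_def by blast
  have "y \<in> convex hull V"
    using assms(3) unfolding V(3)[symmetric] by (simp add: dual_polytope_def inner_commute)
  then obtain l where l: "\<And>s. s \<in> V \<Longrightarrow> 0 \<le> l s" "sum l V = 1" "(\<Sum>s\<in>V. l s *\<^sub>R s) = y"
    by (auto simp: convex_hull_finite[OF V(1)])
  obtain s where s: "s \<in> V" "l s \<noteq> 0"
    using l(2) by (metis sum.neutral zero_neq_one)
  have sle: "x \<bullet> t \<le> 1" if "x \<in> P" "t \<in> V" for x t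
    using that hull_subset[of V convex] V(3) by (auto simp: dual_polytope_def)
  have "s \<bullet> b = 1" if "b \<in> B" for b
  proof -
    \<comment> \<open>The weighted slacks are nonnegative and add up to
      \<open>1 - y \<bullet> b\<close>, which is 0.\<close>
    have "(\<Sum>t\<in>V. l t * (1 - b \<bullet> t)) = sum l V - b \<bullet> (\<Sum>t\<in>V. l t *\<^sub>R t)"
      by (simp add: inner_sum_right right_diff_distrib sum_subtractf)
    then have "(\<Sum>t\<in>V. l t * (1 - b \<bullet> t)) = 0"
      using B(2)[OF that] l by (simp add: inner_commute)
    moreover have "\<And>t. t \<in> V \<Longrightarrow> 0 \<le> l t * (1 - b \<bullet> t)"
      using l(1) sle BP that by (auto intro!: mult_nonneg_nonneg)
    ultimately have "l s * (1 - b \<bullet> s) = 0"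
      using sum_nonneg_eq_0_iff[OF V(1), of "\<lambda>t. l t * (1 - b \<bullet> t)"] s(1) by blast
    then show ?thesis using s(2) by (simp add: inner_commute)
  qed
  then have "\<And>b. b \<in> B \<Longrightarrow> orthogonal (s - y) b"
    using B(2) by (simp add: orthogonal_def inner_diff_left)
  then have "orthogonal (s - y) (s - y)"
    using orthogonal_to_span[of "s - y" B "s - y"] sp by blast
  then show "y \<in> int_lattice" using s(1) V(2) by (auto simp: orthogonal_def)
  let ?G = "P \<inter> {x. y \<bullet> x = 1}"
  have face: "?G face_of P"
    using face_of_Int_supporting_hyperplane_le[OF reflexive_polytope(4)[OF assms(1)]] assms(3) by blast
  have "B \<noteq> {}" using assms(7) by auto
  then have "y \<noteq> 0" using B(2) by force
  have BG: "B \<subseteq> ?G" using BP B(2) by auto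
  \<comment> \<open>Linear independence gives affine independence, so the dimension of the face is
    pinned between those of \<open>B\<close> and of the hyperplane.\<close>
  have "aff_dim B = int (CARD('n)) - 1"
    using assms(6,7) aff_dim_affine_independent[of B] affine_dependent_imp_dependent[of B] by fastforce
  moreover have "aff_dim B \<le> aff_dim ?G" using BG by (rule aff_dim_subset)
  moreover have "aff_dim ?G \<le> aff_dim {x. y \<bullet> x = 1}" by (rule aff_dim_subset) auto
  moreover have "aff_dim {x. y \<bullet> x = 1} = int CARD('n) - 1"
    using \<open>y \<noteq> 0\<close> by simp
  ultimately have ad: "aff_dim ?G = int CARD('n) - 1" by linarith
  moreover have "aff_dim P = int CARD('n)" using assms(1) by (simp add: reflexive_def)
  ultimately have "?G facet_of P"
    using face BG \<open>B \<noteq> {}\<close> unfolding facet_of_def by auto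
  then obtain k where "k simplex ?G" using assms(2) unfolding simplicial_def by blast
  then obtain C where C: "\<not> affine_dependent C" "?G = convex hull C" "int (card C) = k + 1"
    unfolding simplex_def by blast
  have "aff_dim ?G = int (card C) - 1"
    using C(1,2) by (simp add: aff_dim_convex_hull aff_dim_affine_independent)
  then have cC: "card C = CARD('n)" using ad by simp
  have inC: "x \<in> C" if "x extreme_point_of P" "y \<bullet> x = 1" for x
  proof -
    have "x extreme_point_of ?G"
      using extreme_point_of_face[OF face] that by (auto simp: extreme_point_of_def)
    then show ?thesis using C(2) extreme_point_of_convex_hull by metis
  qed
  have "B \<subseteq> C" using inC B by blast
  moreover have "finite C" using C(1) aff_independent_finite by blast
  ultimately have "B = C" using cC assms(7) card_subset_eq by metis
  then show "\<And>x. x extreme_point_of P \<Longrightarrow> y \<bullet> x = 1 \<Longrightarrow> x \<in> B" using inC by blast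
qed

text \<open>\<open>v\<close> lists the vertices of a facet whose negative is a facet too, \<open>c\<close> is the dual basis and
  \<open>u\<close> the functional defining the facet.\<close>
locale facet_frame =
  fixes P :: "(real ^ 'n) set" and v c :: "'n \<Rightarrow> real ^ 'n" and u :: "real ^ 'n"
  assumes reflexive: "reflexive P" and simplicial: "simplicial P"
    and dual: "c i \<bullet> v j = (if i = j then 1 else 0)"
    and u_v: "u \<bullet> v i = 1"
    and u_le: "x \<in> P \<Longrightarrow> u \<bullet> x \<le> 1" and u_ge: "x \<in> P \<Longrightarrow> - 1 \<le> u \<bullet> x"
    and ext: "v i extreme_point_of P" and ext_neg: "- v i extreme_point_of P"

text \<open>Exchanging the two opposite facets gives every statement about negative coordinates a
  mirror image.\<close>

lemma facet_frame_uminus: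
  "facet_frame P v c u \<Longrightarrow> facet_frame P (\<lambda>i. - v i) (\<lambda>i. - c i) (- u)"
  unfolding facet_frame_def by (simp add: minus_le_iff)

context facet_frame
begin

text \<open>Taking coordinates is a left inverse of the linear map \<open>g\<close>; in finite
  dimension it is a right inverse too.\<close>

lemma expand: "x = (\<Sum>i\<in>UNIV. (c i \<bullet> x) *\<^sub>R v i)"
proof -
  define f where "f x = (\<chi> i. c i \<bullet> x)" for x
  define g where "g a = (\<Sum>i\<in>UNIV. a $ i *\<^sub>R v i)" for a :: "real ^ 'n"
  have "linear f" unfolding f_def
    by (rule linearI) (simp_all add: vec_eq_iff inner_add_right)
  moreover have "linear g" unfolding g_def
    by (rule linearI) (simp_all add: scaleR_left_distrib sum.distrib scaleR_sum_right)
  moreover have "f \<circ> g = id"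
    by (auto simp: fun_eq_iff f_def g_def vec_eq_iff inner_sum_right dual if_distrib cong: if_cong)
  ultimately have "g \<circ> f = id" using linear_inverse_left by blast
  then have "g (f x) = x" by (metis comp_apply id_apply)
  then show ?thesis by (simp add: f_def g_def)
qed

lemma coords_eqI: "(\<And>i. c i \<bullet> x = c i \<bullet> y) \<Longrightarrow> x = y"
  by (subst expand, subst (2) expand) simp

lemma sum_coords: "(\<Sum>i\<in>UNIV. c i \<bullet> x) = u \<bullet> x"
  by (subst (2) expand) (simp add: inner_sum_right u_v)

text \<open>An exchange argument: the \<open>v j\<close> with \<open>j \<noteq> i\<close> are in the
  range up to sign, and the nonzero coordinate of \<open>f i\<close> recovers \<open>v i\<close>. So
  the range spans, and having at most \<open>CARD('n)\<close> elements it is a basis.\<close>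

lemma modified_basis:
  assumes "\<And>j. j \<noteq> i \<Longrightarrow> f j = v j \<or> f j = - v j" "c i \<bullet> f i \<noteq> 0"
  shows "independent (range f)" "card (range f) = CARD('n)"
proof -
  have 1: "v j \<in> span (range f)" if "j \<noteq> i" for j
  proof -
    have "f j \<in> span (range f)" by (simp add: span_base)
    then show ?thesis using assms(1)[OF that] span_neg by force
  qed
  have "f i = (c i \<bullet> f i) *\<^sub>R v i + (\<Sum>j\<in>UNIV - {i}. (c j \<bullet> f i) *\<^sub>R v j)"
    by (subst expand) (simp add: sum.remove[of _ i])
  then have "(c i \<bullet> f i) *\<^sub>R v i = f i - (\<Sum>j\<in>UNIV - {i}. (c j \<bullet> f i) *\<^sub>R v j)"
    by (simp add: algebra_simps)
  moreover have "\<dots> \<in> span (range f)"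
    by (intro span_diff span_sum span_mul 1) (auto simp: span_base)
  ultimately have "(c i \<bullet> f i) *\<^sub>R v i \<in> span (range f)" by simp
  from span_mul[OF this, of "inverse (c i \<bullet> f i)"] have "v i \<in> span (range f)"
    using assms(2) by simp
  with 1 have "v j \<in> span (range f)" for j by (cases "j = i") auto
  then have "x \<in> span (range f)" for x
    by (subst expand) (intro span_sum span_mul)
  then have sp: "UNIV \<subseteq> span (range f)" by blast
  have "card (range f) \<le> CARD('n)" by (rule card_image_le) simp
  then show ind: "independent (range f)"
    using card_le_dim_spanning[of "range f" UNIV] sp by (simp add: dim_UNIV)
  show "card (range f) = CARD('n)"
    using basis_card_eq_dim[of "range f" UNIV] sp ind by (simp add: dim_UNIV)
qed

lemma u_int: "u \<in> int_lattice"
  and u_tight: "x extreme_point_of P \<Longrightarrow> u \<bullet> x = 1 \<Longrightarrow> x \<in> range v"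
proof -
  \<comment> \<open>No vector is exchanged here, so any index serves as the \<open>i\<close> of
    \<open>modified_basis\<close>.\<close>
  have "independent (range v)" "card (range v) = CARD('n)"
    using modified_basis[of undefined v] by (simp_all add: dual)
  then show "u \<in> int_lattice" "x extreme_point_of P \<Longrightarrow> u \<bullet> x = 1 \<Longrightarrow> x \<in> range v"
    using tight_functional[OF reflexive simplicial u_le, of "range v"] u_v ext by auto
qed

lemma extreme_int: "x extreme_point_of P \<Longrightarrow> x \<in> int_lattice"
  using reflexive_polytope(2)[OF reflexive] by blast

lemma extreme_in: "x extreme_point_of P \<Longrightarrow> x \<in> P"
  by (simp add: extreme_point_of_def)

text \<open>The facet adjacent to \<open>v\<close> across the ridge omitting \<open>v i\<close>.\<close>
lemma neighbour:
  obtains \<alpha> :: real and w where "\<alpha> = 1 \<or> \<alpha> = 2" "\<alpha> *\<^sub>R c i \<in> int_lattice"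
    "\<And>x. x extreme_point_of P \<Longrightarrow> u \<bullet> x - \<alpha> * (c i \<bullet> x) \<le> 1"
    "\<And>x. x extreme_point_of P \<Longrightarrow> u \<bullet> x - \<alpha> * (c i \<bullet> x) = 1 \<Longrightarrow> x \<in> range (v(i := w))"
proof -
  \<comment> \<open>A ratio test as in the simplex method: the functionals
    \<open>u - \<alpha> *\<^sub>R c i\<close> tilt about the ridge until, at the least ratio
    \<open>h\<close>, a further vertex \<open>w\<close> becomes tight. The vertex
    \<open>- v i\<close> keeps \<open>S\<close> nonempty and has ratio 2.\<close>
  define S where "S = {x. x extreme_point_of P \<and> c i \<bullet> x < 0}"
  define h where "h x = (1 - u \<bullet> x) / (- (c i \<bullet> x))" for x
  define \<alpha> where "\<alpha> = Min (h ` S)"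
  have fS: "finite S" using reflexive_polytope(1)[OF reflexive] by (simp add: S_def)
  have vS: "- v i \<in> S" using ext_neg dual by (simp add: S_def)
  have "\<alpha> \<in> h ` S" unfolding \<alpha>_def using fS vS by (intro Min_in) auto
  then obtain w where w: "w \<in> S" "\<alpha> = h w" by blast
  have \<alpha>_le: "\<alpha> \<le> h x" if "x \<in> S" for x
    unfolding \<alpha>_def using fS that by (intro Min_le) auto
  have wext: "w extreme_point_of P" and wneg: "c i \<bullet> w < 0" using w(1) by (auto simp: S_def)
  have "u \<bullet> w \<noteq> 1"
    using u_tight[OF wext] wneg dual by (auto split: if_splits)
  then have "u \<bullet> w < 1" using u_le[OF extreme_in[OF wext]] by linarith
  then have \<alpha>_pos: "0 < \<alpha>" using w(2) wneg by (simp add: h_def divide_pos_neg zero_less_divide_iff)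
  define y where "y = u - \<alpha> *\<^sub>R c i"
  have y: "y \<bullet> x = u \<bullet> x - \<alpha> * (c i \<bullet> x)" for x by (simp add: y_def inner_diff_left)
  have yle: "y \<bullet> x \<le> 1" if "x extreme_point_of P" for x
  proof (cases "c i \<bullet> x < 0")
    case True
    then have "\<alpha> \<le> (1 - u \<bullet> x) / (- (c i \<bullet> x))" using \<alpha>_le[of x] that by (simp add: S_def h_def)
    then have "\<alpha> * (- (c i \<bullet> x)) \<le> 1 - u \<bullet> x" using True by (subst (asm) pos_le_divide_eq) auto
    then show ?thesis unfolding y by linarith
  next
    case False
    then have "0 \<le> \<alpha> * (c i \<bullet> x)" using \<alpha>_pos by simp
    then show ?thesis using u_le[OF extreme_in[OF that]] unfolding y by linarith
  qed
  have yw: "y \<bullet> w = 1" using w(2) wneg unfolding y h_def by (simp add: field_simps)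
  let ?f = "v(i := w)"
  have b: "independent (range ?f)" "card (range ?f) = CARD('n)"
    using modified_basis[of i ?f] wneg by auto
  have e: "x extreme_point_of P" and t: "y \<bullet> x = 1" if "x \<in> range ?f" for x
    using that ext wext yw by (auto simp: y u_v dual split: if_splits)
  note T = tight_functional[OF reflexive simplicial extreme_points_le[OF reflexive yle] e t b]
  have yint: "y \<in> int_lattice" by (rule T(1)) auto
  \<comment> \<open>Integrality at \<open>v i\<close>, where \<open>y\<close> takes the value
    \<open>1 - \<alpha>\<close>, and the ratio of \<open>- v i\<close> leave only 1 and 2 for
    \<open>\<alpha>\<close>.\<close>
  have "y \<bullet> v i \<in> \<int>" using inner_int_lattice[OF yint extreme_int[OF ext]] .
  then have "1 - (1 - \<alpha>) \<in> \<int>" unfolding y u_v dual by (intro Ints_diff) auto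
  then obtain k where k: "\<alpha> = of_int k" by (auto elim: Ints_cases)
  have "\<alpha> \<le> 2" using \<alpha>_le[OF vS] by (simp add: h_def u_v dual)
  then have "\<alpha> = 1 \<or> \<alpha> = 2" using \<alpha>_pos k by auto
  moreover have "\<alpha> *\<^sub>R c i \<in> int_lattice"
    using int_lattice_diff[OF u_int yint] by (simp add: y_def)
  moreover have "u \<bullet> x - \<alpha> * (c i \<bullet> x) \<le> 1" if "x extreme_point_of P" for x
    using yle[OF that] by (simp add: y)
  moreover have "x \<in> range ?f" if "x extreme_point_of P" "u \<bullet> x - \<alpha> * (c i \<bullet> x) = 1" for x
    using T(2)[of x] that by (simp add: y)
  ultimately show ?thesis using that by blast
qed

lemma half_int_coords: "x \<in> int_lattice \<Longrightarrow> 2 * (c i \<bullet> x) \<in> \<int>"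
proof -
  assume x: "x \<in> int_lattice"
  obtain \<alpha> :: real where "\<alpha> = 1 \<or> \<alpha> = 2" "\<alpha> *\<^sub>R c i \<in> int_lattice" by (rule neighbour[of i])
  moreover from this have "\<alpha> * (c i \<bullet> x) \<in> \<int>" using inner_int_lattice[OF _ x] by fastforce
  ultimately show ?thesis by (auto intro: Ints_mult)
qed

section \<open>Vertices between the two opposite facets\<close>

definition equator :: "(real ^ 'n) set" where
  "equator = {x. x extreme_point_of P \<and> u \<bullet> x = 0}"

text \<open>At an equator vertex \<open>x\<close> with negative coordinate the neighbouring
  functional takes the value \<open>- \<alpha> * (c i \<bullet> x)\<close>, a positive integer that
  is at most 1. So \<open>x\<close> is tight there, and the only tight vertex that can lie off the
  first facet is \<open>w'\<close>. If \<open>\<alpha>\<close> were 2, \<open>- v i\<close> would be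
  tight as well, although \<open>u\<close> is -1 on it.\<close>

lemma equator_neg:
  assumes "w \<in> equator" "c i \<bullet> w < 0"
  shows "c i \<bullet> w = - 1" "c i \<in> int_lattice" "\<And>x. x \<in> equator \<Longrightarrow> c i \<bullet> x < 0 \<Longrightarrow> x = w"
proof -
  obtain \<alpha> :: real and w' where \<alpha>: "\<alpha> = 1 \<or> \<alpha> = 2" "\<alpha> *\<^sub>R c i \<in> int_lattice"
    and le: "\<And>x. x extreme_point_of P \<Longrightarrow> u \<bullet> x - \<alpha> * (c i \<bullet> x) \<le> 1"
    and tight: "\<And>x. x extreme_point_of P \<Longrightarrow> u \<bullet> x - \<alpha> * (c i \<bullet> x) = 1 \<Longrightarrow> x \<in> range (v(i := w'))"
    by (rule neighbour[of i]) blast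
  have *: "\<alpha> * (c i \<bullet> x) = - 1 \<and> x = w'" if "x \<in> equator" "c i \<bullet> x < 0" for x
  proof -
    have x: "x extreme_point_of P" "u \<bullet> x = 0" using that by (auto simp: equator_def)
    have "\<alpha> * (c i \<bullet> x) \<in> \<int>"
      using inner_int_lattice[OF \<alpha>(2) extreme_int[OF x(1)]] by simp
    moreover have "\<alpha> * (c i \<bullet> x) < 0" using \<alpha>(1) that(2) by auto
    moreover have "- 1 \<le> \<alpha> * (c i \<bullet> x)" using le[OF x(1)] x(2) by simp
    ultimately have "\<alpha> * (c i \<bullet> x) = - 1" by (auto elim!: Ints_cases)
    moreover from this have "x \<in> range (v(i := w'))" using tight[OF x(1)] x(2) by simp
    ultimately show ?thesis using u_v x(2) by (auto split: if_splits)
  qed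
  have "\<alpha> \<noteq> 2"
  proof
    assume "\<alpha> = 2"
    then have "- v i \<in> range (v(i := w'))" using tight[OF ext_neg[of i]] by (simp add: u_v dual)
    then obtain j where "- v i = (v(i := w')) j" by blast
    then have "u \<bullet> (- v i) = u \<bullet> (v(i := w')) j" by simp
    then show False using u_v *[OF assms] assms(1) by (auto simp: equator_def split: if_splits)
  qed
  then have "\<alpha> = 1" using \<alpha>(1) by simp
  then show "c i \<bullet> w = - 1" "c i \<in> int_lattice" "\<And>x. x \<in> equator \<Longrightarrow> c i \<bullet> x < 0 \<Longrightarrow> x = w"
    using * assms \<alpha>(2) by auto
qed

lemma frame_neg: "facet_frame P (\<lambda>i. - v i) (\<lambda>i. - c i) (- u)"
  by (rule facet_frame_uminus) (rule facet_frame_axioms)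

lemma equator_frame_neg: "facet_frame.equator P (- u) = equator"
  by (simp add: facet_frame.equator_def[OF frame_neg] equator_def)

lemma equator_pos:
  assumes "w \<in> equator" "0 < c i \<bullet> w"
  shows "c i \<bullet> w = 1" "c i \<in> int_lattice" "\<And>x. x \<in> equator \<Longrightarrow> 0 < c i \<bullet> x \<Longrightarrow> x = w"
proof -
  have w: "- c i \<bullet> w < 0" using assms(2) by simp
  note N = facet_frame.equator_neg[OF frame_neg, unfolded equator_frame_neg, OF assms(1) w]
  show "c i \<bullet> w = 1" using N(1) by simp
  show "c i \<in> int_lattice" using int_lattice_uminus[OF N(2)] by simp
  show "x = w" if "x \<in> equator" "0 < c i \<bullet> x" for x
    by (rule N(3)) (use that in simp_all)
qed

lemma equator_coord: "w \<in> equator \<Longrightarrow> c i \<bullet> w = - 1 \<or> c i \<bullet> w = 0 \<or> c i \<bullet> w = 1"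
  using equator_neg(1)[of w i] equator_pos(1)[of w i] by linarith

text \<open>The values of \<open>u\<close> on vertices are integers between -1 and 1, and the
  extreme values are taken only on the two facets.\<close>

lemma extreme_cases:
  assumes "x extreme_point_of P"
  shows "x \<in> range v \<or> - x \<in> range v \<or> x \<in> equator"
proof -
  have "u \<bullet> x \<in> \<int>" by (rule inner_int_lattice[OF u_int extreme_int[OF assms]])
  then have "u \<bullet> x = 1 \<or> u \<bullet> x = - 1 \<or> u \<bullet> x = 0"
    using u_le[OF extreme_in[OF assms]] u_ge[OF extreme_in[OF assms]] by (auto elim!: Ints_cases)
  then show ?thesis
    using u_tight[OF assms] facet_frame.u_tight[OF frame_neg assms] assms
    by (force simp: equator_def)
qed

text \<open>Otherwise \<open>u - c i - 2 c k\<close> would define a facet with the \<open>d + 1\<close> vertices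
  \<open>v j\<close> for \<open>j \<noteq> i, k\<close>, \<open>- v k\<close>, \<open>w\<close> and \<open>w'\<close>.\<close>
lemma equator_overlap:
  assumes w: "w \<in> equator" "w' \<in> equator" and i: "c i \<bullet> w = - 1" "c i \<bullet> w' = 1"
    and k: "c k \<bullet> w' = - 1"
  shows "c k \<bullet> w = 1"
proof (rule ccontr)
  assume "c k \<bullet> w \<noteq> 1"
  have ne: "w \<noteq> w'" "i \<noteq> k" using i k by auto
  have "c k \<bullet> w \<noteq> - 1" using equator_neg(3)[OF w(2), of k w] w(1) k ne by auto
  then have k0: "c k \<bullet> w = 0" using equator_coord[OF w(1)] \<open>c k \<bullet> w \<noteq> 1\<close> by blast
  define y where "y = u - c i - 2 *\<^sub>R c k"
  have y: "y \<bullet> x = u \<bullet> x - c i \<bullet> x - 2 * (c k \<bullet> x)" for x by (simp add: y_def inner_diff_left)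
  have yle: "y \<bullet> x \<le> 1" if "x extreme_point_of P" for x
    using extreme_cases[OF that]
  proof (elim disjE)
    assume "x \<in> range v"
    then show ?thesis by (auto simp: y u_v dual)
  next
    assume "- x \<in> range v"
    then obtain j where "x = - v j" by (metis add.inverse_inverse imageE)
    then show ?thesis using ne by (auto simp: y u_v dual)
  next
    assume x: "x \<in> equator"
    \<comment> \<open>On the equator only \<open>w'\<close> has coordinate -1 at \<open>k\<close>,
      and there \<open>y\<close> is \<open>0 - 1 + 2\<close>. Otherwise
      \<open>c k \<bullet> x\<close> is 0 or 1, which keeps \<open>y \<bullet> x\<close> at most
      1.\<close>
    show ?thesis
    proof (cases "c k \<bullet> x = - 1")
      case True
      then have "x = w'" using equator_neg(3)[OF w(2), of k x] x k by simp
      then show ?thesis using w(2) i(2) k by (simp add: y equator_def)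
    next
      case False
      then show ?thesis using equator_coord[OF x, of i] equator_coord[OF x, of k] x
        by (auto simp: y equator_def)
    qed
  qed
  \<comment> \<open>These independent vertices are tight for \<open>y\<close>, so \<open>w'\<close>,
    being tight too, would be one of them. But \<open>u\<close> is 0 on \<open>w'\<close>, while it
    is 1 or -1 on all of them except \<open>w\<close>, which differs from \<open>w'\<close>.\<close>
  let ?f = "(v(i := w))(k := - v k)"
  have b: "independent (range ?f)" "card (range ?f) = CARD('n)"
    using modified_basis[of i ?f] ne i by auto
  have e: "x extreme_point_of P" and t: "y \<bullet> x = 1" if "x \<in> range ?f" for x
    using that ext ext_neg w ne i k0 by (auto simp: y u_v dual equator_def split: if_splits)
  have "w' \<in> range ?f"
  proof (rule tight_functional(2)[OF reflexive simplicial extreme_points_le[OF reflexive yle] e t b])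
    show "w' extreme_point_of P" "y \<bullet> w' = 1" using w(2) i k by (auto simp: equator_def y)
  qed auto
  then obtain j where j: "w' = ?f j" by blast
  then have "u \<bullet> w' = u \<bullet> ?f j" by simp
  then show False using ne j w u_v by (auto simp: equator_def split: if_splits)
qed

text \<open>Overlap, applied in both frames and with the roles of \<open>w\<close> and
  \<open>w'\<close> exchanged, matches the coordinates 1 of each vector with the coordinates -1 of
  the other. The second pair of applications starts from a coordinate where \<open>w\<close> is 1,
  which exists since the coordinates of \<open>w\<close> sum to 0.\<close>

lemma equator_opposite:
  assumes w: "w \<in> equator" "w' \<in> equator" and i: "c i \<bullet> w = - 1" "c i \<bullet> w' = 1"
  shows "w' = - w"
proof -
  have 1: "c k \<bullet> w' = - 1 \<Longrightarrow> c k \<bullet> w = 1" for k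
    using equator_overlap[OF w i] by blast
  have 2: "c k \<bullet> w = 1 \<Longrightarrow> c k \<bullet> w' = - 1" for k
    using facet_frame.equator_overlap[OF frame_neg, unfolded equator_frame_neg, OF w(2,1), of i k] i
    by simp
  have "\<exists>k. c k \<bullet> w = 1"
  proof (rule ccontr)
    assume *: "\<nexists>k. c k \<bullet> w = 1"
    have "(\<Sum>k\<in>UNIV. c k \<bullet> w) < (\<Sum>k\<in>(UNIV::'n set). 0)"
    proof (rule sum_strict_mono_ex1)
      show "\<forall>k\<in>UNIV. c k \<bullet> w \<le> 0" using equator_coord[OF w(1)] * by (metis order.refl zero_le_one neg_le_0_iff_le)
      show "\<exists>k\<in>UNIV. c k \<bullet> w < 0" using i by (intro bexI[of _ i]) auto
    qed simp
    then show False using w(1) unfolding sum_coords by (simp add: equator_def)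
  qed
  then obtain k where k: "c k \<bullet> w' = - 1" "c k \<bullet> w = 1" using 2 by blast
  have 3: "c j \<bullet> w = - 1 \<Longrightarrow> c j \<bullet> w' = 1" for j
    using equator_overlap[OF w(2,1) k] by blast
  have 4: "c j \<bullet> w' = 1 \<Longrightarrow> c j \<bullet> w = - 1" for j
    using facet_frame.equator_overlap[OF frame_neg, unfolded equator_frame_neg, OF w, of k j] k
    by simp
  show ?thesis
  proof (rule coords_eqI)
    fix j
    show "c j \<bullet> w' = c j \<bullet> (- w)"
      using equator_coord[OF w(1), of j] equator_coord[OF w(2), of j] 1[of j] 2[of j] 3[of j] 4[of j]
      unfolding inner_minus_right by argo
  qed
qed

text \<open>Equal signs at a common coordinate are settled by uniqueness, opposite signs by
  \<open>equator_opposite\<close>.\<close>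

lemma equator_disjoint:
  assumes w: "w \<in> equator" "w' \<in> equator" and i: "c i \<bullet> w \<noteq> 0" "c i \<bullet> w' \<noteq> 0"
  shows "w' = w \<or> w' = - w"
proof -
  consider "c i \<bullet> w = - 1" "c i \<bullet> w' = - 1" | "c i \<bullet> w = 1" "c i \<bullet> w' = 1"
    | "c i \<bullet> w = - 1" "c i \<bullet> w' = 1" | "c i \<bullet> w = 1" "c i \<bullet> w' = - 1"
    using equator_coord[OF w(1), of i] equator_coord[OF w(2), of i] i by argo
  then show ?thesis
  proof cases
    case 1
    then show ?thesis using equator_neg(3)[OF w(1), of i w'] w by simp
  next
    case 2
    then show ?thesis using equator_pos(3)[OF w(1), of i w'] w by simp
  next
    case 3
    then show ?thesis using equator_opposite[OF w, of i] by simp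
  next
    case 4
    then show ?thesis using equator_opposite[OF w(2,1), of i] by simp
  qed
qed

end

section \<open>Existence of a facet frame\<close>

text \<open>Facets of a polytope are exposed, and since 0 is interior, the right-hand side of the
  supporting inequality is positive and can be scaled to 1.\<close>

lemma facet_functional:
  fixes P :: "(real ^ 'n) set"
  assumes "reflexive P" "F facet_of P"
  obtains u where "F = P \<inter> {x. u \<bullet> x = 1}" "\<And>x. x \<in> P \<Longrightarrow> u \<bullet> x \<le> 1"
proof -
  have "polytope P"
    using reflexive_polytope(1,3)[OF assms(1)] unfolding polytope_def by blast
  then have "F exposed_face_of P"
    using assms(2) exposed_face_of_polyhedron polytope_imp_polyhedron facet_of_imp_face_of by blast
  then obtain a b where ab: "P \<subseteq> {x. a \<bullet> x \<le> b}" "F = P \<inter> {x. a \<bullet> x = b}"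
    unfolding exposed_face_of_def by blast
  have "F \<noteq> {}" "F \<noteq> P" using assms(2) by (auto simp: facet_of_def)
  then have "a \<noteq> 0" using ab by auto
  moreover have "0 \<in> interior P" using assms(1) unfolding reflexive_def by blast
  ultimately have "0 < b"
    using interior_mono[OF ab(1)] by (auto simp: interior_halfspace_le)
  show ?thesis
  proof (rule that[of "(1 / b) *\<^sub>R a"])
    show "F = P \<inter> {x. (1 / b) *\<^sub>R a \<bullet> x = 1}" using ab(2) \<open>0 < b\<close> by (auto simp: field_simps)
    show "(1 / b) *\<^sub>R a \<bullet> x \<le> 1" if "x \<in> P" for x
      using ab(1) that \<open>0 < b\<close> by (auto simp: field_simps)
  qed
qed

lemma extreme_point_of_uminus:
  fixes S :: "'a::real_vector set"
  assumes "x extreme_point_of S"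
  shows "- x extreme_point_of uminus ` S"
proof -
  have "x \<in> open_segment a b" if "- x \<in> open_segment (- a) (- b)" for a b :: 'a
    using that unfolding in_segment
    by (metis add_uminus_conv_diff minus_add_distrib neg_equal_iff_equal scaleR_minus_right)
  then show ?thesis using assms unfolding extreme_point_of_def by blast
qed

text \<open>The vertices of the facet form a basis, and their negatives are the vertices of the
  opposite facet. The two facet functionals are opposite on this basis, hence everywhere.\<close>

lemma facet_frame_exists:
  fixes P :: "(real ^ 'n) set"
  assumes "reflexive P" "simplicial P" "pseudo_symmetric P"
  obtains v c :: "'n \<Rightarrow> real ^ 'n" and u where "facet_frame P v c u"
proof -
  obtain F where F: "F facet_of P" "uminus ` F facet_of P"
    using assms(3) unfolding pseudo_symmetric_def by blast
  obtain u where u: "F = P \<inter> {x. u \<bullet> x = 1}" "\<And>x. x \<in> P \<Longrightarrow> u \<bullet> x \<le> 1"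
    using facet_functional[OF assms(1) F(1)] by blast
  obtain u' where u': "uminus ` F = P \<inter> {x. u' \<bullet> x = 1}" "\<And>x. x \<in> P \<Longrightarrow> u' \<bullet> x \<le> 1"
    using facet_functional[OF assms(1) F(2)] by blast
  obtain k where "k simplex F" using assms(2) F(1) unfolding simplicial_def by blast
  then obtain C where C: "\<not> affine_dependent C" "F = convex hull C"
    unfolding simplex_def by blast
  have fC: "finite C" using C(1) aff_independent_finite by blast
  have "aff_dim F = int (card C) - 1"
    using C by (simp add: aff_dim_convex_hull aff_dim_affine_independent)
  moreover have "aff_dim F = aff_dim P - 1" using F(1) by (simp add: facet_of_def)
  ultimately have cC: "card C = CARD('n)" using assms(1) by (simp add: reflexive_def)
  have CF: "C \<subseteq> F" using C(2) hull_subset[of C convex] by simp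
  \<comment> \<open>The hyperplane of \<open>F\<close> misses the origin, which upgrades affine to
    linear independence.\<close>
  have "affine hull C \<subseteq> {x. u \<bullet> x = 1}"
    using CF u(1) by (intro hull_minimal affine_hyperplane) auto
  then have "0 \<notin> affine hull C" by auto
  then have "\<not> affine_dependent (insert 0 C)" using C(1) affine_independent_insert by blast
  moreover have "0 \<notin> C" using CF u(1) by auto
  ultimately have ind: "independent C" by (simp add: affine_dependent_iff_dependent)
  obtain v :: "'n \<Rightarrow> real ^ 'n" where v: "bij_betw v UNIV C"
    using finite_same_card_bij[of "UNIV :: 'n set" C] fC cC by auto
  have inj: "inj v" and ran: "range v = C" using v by (auto simp: bij_betw_def)
  \<comment> \<open>\<open>f\<close> sends the basis \<open>C\<close> to the axes; its adjoint sends
    the axes to the dual basis.\<close>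
  obtain f :: "real ^ 'n \<Rightarrow> real ^ 'n" where f: "linear f" "\<And>x. x \<in> C \<Longrightarrow> f x = axis (inv v x) 1"
    using linear_independent_extend[OF ind, of "\<lambda>x. axis (inv v x) 1"] by blast
  define c where "c i = adjoint f (axis i 1)" for i :: 'n
  have dual: "c i \<bullet> v j = (if i = j then 1 else 0)" for i j
  proof -
    have "v j \<bullet> c i = f (v j) \<bullet> axis i 1" unfolding c_def by (rule adjoint_works[OF f(1)])
    also have "f (v j) = axis j 1" using f(2)[of "v j"] ran inj by (auto simp: inv_f_f)
    finally show ?thesis by (simp add: inner_commute inner_axis_axis)
  qed
  have vF: "v i \<in> F" for i using CF ran by blast
  have uv: "u \<bullet> v i = 1" for i using vF u(1) by auto
  have "u' \<bullet> (- v i) = 1" for i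
  proof -
    have "- v i \<in> uminus ` F" using vF by blast
    then show ?thesis unfolding u'(1) by simp
  qed
  then have "orthogonal (u + u') x" if "x \<in> C" for x
    using that uv ran by (auto simp: orthogonal_def inner_add_left)
  moreover have "span C = UNIV"
    using card_eq_dim[of C UNIV] fC cC ind by (auto simp: dim_UNIV)
  ultimately have "orthogonal (u + u') (u + u')"
    using orthogonal_to_span[of "u + u'" C "u + u'"] by blast
  then have "u' = - u" by (simp add: orthogonal_def add_eq_0_iff)
  have ext: "v i extreme_point_of F" for i
    using extreme_point_of_convex_hull_affine_independent[OF C(1)] C(2) ran by blast
  show ?thesis
  proof (rule that[of v c u], unfold_locales)
    show "v i extreme_point_of P" for i
      using ext extreme_point_of_face[OF facet_of_imp_face_of[OF F(1)]] by blast
    show "- v i extreme_point_of P" for i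
      using extreme_point_of_uminus[OF ext] extreme_point_of_face[OF facet_of_imp_face_of[OF F(2)]]
      by blast
    show "- 1 \<le> u \<bullet> x" if "x \<in> P" for x
      using u'(2)[OF that] \<open>u' = - u\<close> by simp
  qed (use assms dual uv u(2) in auto)
qed

text \<open>A facet frame with the signs of \<open>v\<close> changed such that all vertices other than \<open>\<plusminus>v i\<close> are sums of
  the \<open>v i\<close> over the blocks \<open>BB\<close>, or (blocks in \<open>BB2\<close>) negatives of such sums.\<close>
locale block_frame =
  fixes P :: "(real ^ 'n) set" and v c :: "'n \<Rightarrow> real ^ 'n" and BB BB2 :: "'n set set"
  assumes dual: "c i \<bullet> v j = (if i = j then 1 else 0)"
    and expand: "x = (\<Sum>i\<in>UNIV. (c i \<bullet> x) *\<^sub>R v i)"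
    and v_int: "v i \<in> int_lattice"
    and half_int: "x \<in> int_lattice \<Longrightarrow> 2 * (c i \<bullet> x) \<in> \<int>"
    and block_int: "x \<in> int_lattice \<Longrightarrow> B \<in> BB \<Longrightarrow> i \<in> B \<Longrightarrow> c i \<bullet> x \<in> \<int>"
    and even_half: "x \<in> int_lattice \<Longrightarrow> even (card {i. c i \<bullet> x \<notin> \<int>})"
    and disj: "disjoint BB"
    and even_card: "B \<in> BB \<Longrightarrow> even (card B)"
    and sub: "BB2 \<subseteq> BB"
    and hull: "P = convex hull (range v \<union> range (\<lambda>i. - v i) \<union> (\<lambda>B. \<Sum>i\<in>B. v i) ` BB
      \<union> (\<lambda>B. - (\<Sum>i\<in>B. v i)) ` BB2)"

section \<open>From equator vertices to blocks\<close>

context facet_frame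
begin

definition supp :: "real ^ 'n \<Rightarrow> 'n set" where
  "supp w = {i. c i \<bullet> w \<noteq> 0}"

lemma supp_nonempty:
  assumes "w \<in> equator"
  shows "supp w \<noteq> {}"
proof
  assume "supp w = {}"
  then have "w = 0" by (intro coords_eqI) (auto simp: supp_def)
  moreover have "0 \<in> interior P" using reflexive unfolding reflexive_def by blast
  moreover have "w extreme_point_of P" using assms by (simp add: equator_def)
  ultimately show False using extreme_point_not_in_interior by blast
qed

lemma supp_overlap:
  assumes "w \<in> equator" "w' \<in> equator" "supp w \<inter> supp w' \<noteq> {}"
  shows "w' = w \<or> w' = - w"
  using assms equator_disjoint unfolding supp_def by blast

text \<open>The coordinates 1 and -1 on the support cancel, since their sum is
  \<open>u \<bullet> w = 0\<close>.\<close>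

lemma even_supp:
  assumes "w \<in> equator"
  shows "even (card (supp w))"
proof -
  have "0 = (\<Sum>i\<in>UNIV. c i \<bullet> w)" using assms unfolding sum_coords by (simp add: equator_def)
  also have "\<dots> = (\<Sum>i\<in>supp w. c i \<bullet> w)"
    by (rule sum.mono_neutral_right) (auto simp: supp_def)
  also have "\<dots> = (\<Sum>i\<in>supp w. if c i \<bullet> w = - 1 then - 1 else 1)"
    using equator_coord[OF assms] by (intro sum.cong) (auto simp: supp_def)
  also have "\<dots> = real (card (supp w)) - 2 * real (card {i\<in>supp w. c i \<bullet> w = - 1})"
    by (subst sum_if_sign) auto
  finally have "real (card (supp w)) = real (2 * card {i\<in>supp w. c i \<bullet> w = - 1})" by simp
  then show ?thesis unfolding of_nat_eq_iff by simp
qed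

text \<open>The coordinates of a lattice point sum to the integer \<open>u \<bullet> x\<close>,
  which forces an even number of half-integral ones.\<close>

lemma even_half_coords:
  assumes "x \<in> int_lattice"
  shows "even (card {i. c i \<bullet> x \<notin> \<int>})"
proof -
  let ?H = "{i. c i \<bullet> x \<notin> \<int>}"
  have half: "c i \<bullet> x - 1 / 2 \<in> \<int>" if "i \<in> ?H" for i
  proof -
    obtain m where m: "2 * (c i \<bullet> x) = of_int m" using half_int_coords[OF assms, of i] by (auto elim: Ints_cases)
    have "odd m"
    proof
      assume "even m"
      then obtain n where "m = 2 * n" by (elim evenE)
      then have "c i \<bullet> x = of_int n" using m by simp
      then show False using that by simp
    qed
    then obtain n where "m = 2 * n + 1" by (elim oddE)
    then have "c i \<bullet> x - 1 / 2 = of_int n" using m by simp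
    then show ?thesis by simp
  qed
  have "u \<bullet> x = (\<Sum>i\<in>?H. c i \<bullet> x) + (\<Sum>i\<in>- ?H. c i \<bullet> x)"
    unfolding sum_coords[symmetric] by (subst sum.union_disjoint[symmetric]) (auto intro!: sum.cong)
  moreover have "(\<Sum>i\<in>?H. c i \<bullet> x) = (\<Sum>i\<in>?H. c i \<bullet> x - 1 / 2) + real (card ?H) / 2"
    by (simp add: sum_subtractf)
  ultimately have "real (card ?H) / 2 = u \<bullet> x - (\<Sum>i\<in>- ?H. c i \<bullet> x) - (\<Sum>i\<in>?H. c i \<bullet> x - 1 / 2)"
    by linarith
  moreover have "(\<Sum>i\<in>?H. c i \<bullet> x - 1 / 2) \<in> \<int>" by (rule Ints_sum) (rule half)
  moreover have "(\<Sum>i\<in>- ?H. c i \<bullet> x) \<in> \<int>" by (rule Ints_sum) simp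
  ultimately have "real (card ?H) / 2 \<in> \<int>"
    using inner_int_lattice[OF u_int assms] by (simp only: Ints_diff)
  then obtain m where "real (card ?H) / 2 = of_int m" by (auto elim: Ints_cases)
  then have "int (card ?H) = 2 * m" by linarith
  then show ?thesis by presburger
qed

lemma block_frame_exists:
  obtains v' c' :: "'n \<Rightarrow> real ^ 'n" and BB BB2 where "block_frame P v' c' BB BB2"
proof -
  define BB where "BB = supp ` equator"
  \<comment> \<open>Vertices with the same support agree up to sign; \<open>r B\<close> picks one of
    them, and \<open>BB2\<close> records whether its negative is a vertex too.\<close>
  define r where "r B = (SOME w. w \<in> equator \<and> supp w = B)" for B
  have r: "r B \<in> equator" "supp (r B) = B" if "B \<in> BB" for B
    using that someI_ex[of "\<lambda>w. w \<in> equator \<and> supp w = B"] unfolding BB_def r_def by auto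
  define BB2 where "BB2 = {B\<in>BB. - r B \<in> equator}"
  have supp_uminus: "supp (- w) = supp w" for w by (auto simp: supp_def)
  have dj: "A = B" if "A \<in> BB" "B \<in> BB" "A \<inter> B \<noteq> {}" for A B
  proof -
    have "r B = r A \<or> r B = - r A"
      using supp_overlap[of "r A" "r B"] r that by simp
    then show ?thesis using supp_uminus r(2) that by metis
  qed
  define bl where "bl i = (SOME B. B \<in> BB \<and> i \<in> B)" for i
  have bl: "bl i = B" if "B \<in> BB" "i \<in> B" for i B
    using someI[of "\<lambda>B. B \<in> BB \<and> i \<in> B" B] that dj[of "bl i" B] unfolding bl_def by blast
  \<comment> \<open>The sign for \<open>v i\<close> is that of the coordinate of \<open>r\<close> in
    the block of \<open>i\<close>, which turns \<open>r B\<close> into a plain sum.\<close>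
  define \<sigma> where "\<sigma> i = (if i \<in> \<Union>BB then c i \<bullet> r (bl i) else 1)" for i
  have \<sigma>: "\<sigma> i = 1 \<or> \<sigma> i = - 1" for i
  proof (cases "i \<in> \<Union>BB")
    case True
    then obtain B where B: "B \<in> BB" "i \<in> B" by blast
    then have "c i \<bullet> r B \<noteq> 0" using r(2)[of B] by (auto simp: supp_def)
    then show ?thesis using equator_coord[OF r(1)[OF B(1)], of i] bl[OF B] True by (auto simp: \<sigma>_def)
  qed (simp add: \<sigma>_def)
  define v' where "v' i = \<sigma> i *\<^sub>R v i" for i
  define c' where "c' i = \<sigma> i *\<^sub>R c i" for i
  have rB: "r B = (\<Sum>i\<in>B. v' i)" if "B \<in> BB" for B
  proof -
    have "r B = (\<Sum>i\<in>B. (c i \<bullet> r B) *\<^sub>R v i)"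
      by (subst expand, rule sum.mono_neutral_right) (use r(2)[OF that] in \<open>auto simp: supp_def\<close>)
    also have "\<dots> = (\<Sum>i\<in>B. v' i)"
      using bl[OF that] that by (intro sum.cong) (auto simp: v'_def \<sigma>_def)
    finally show ?thesis .
  qed
  have ext_eq: "{x. x extreme_point_of P} = range v' \<union> range (\<lambda>i. - v' i) \<union> (\<lambda>B. \<Sum>i\<in>B. v' i) ` BB
      \<union> (\<lambda>B. - (\<Sum>i\<in>B. v' i)) ` BB2" (is "?E = ?R")
  proof
    have rv: "v i \<in> ?R \<and> - v i \<in> ?R" for i
    proof -
      have "v i = v' i \<or> v i = - v' i" using \<sigma>[of i] by (auto simp: v'_def)
      then show ?thesis by (elim disjE) auto
    qed
    show "?E \<subseteq> ?R"
    proof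
      fix x assume "x \<in> ?E"
      then consider "x \<in> range v" | "- x \<in> range v" | "x \<in> equator" using extreme_cases by blast
      then show "x \<in> ?R"
      proof cases
        case 1
        then show ?thesis using rv by blast
      next
        case 2
        then obtain i where "x = - v i" by (metis add.inverse_inverse imageE)
        then show ?thesis using rv by blast
      next
        case 3
        then have B: "supp x \<in> BB" by (simp add: BB_def)
        then have "x = r (supp x) \<or> x = - r (supp x)"
          using supp_overlap[OF r(1)[OF B] 3] r(2)[OF B] supp_nonempty[OF 3] by auto
        moreover have "supp x \<in> BB2" if "x = - r (supp x)"
          using that 3 B unfolding BB2_def by simp
        ultimately show ?thesis using rB[OF B] B by fastforce
      qed
    qed
    have "v' i extreme_point_of P" "- v' i extreme_point_of P" for i
      using \<sigma>[of i] ext[of i] ext_neg[of i] by (auto simp: v'_def)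
    moreover have "(\<Sum>i\<in>B. v' i) extreme_point_of P" if "B \<in> BB" for B
      using r(1)[OF that] rB[OF that] by (simp add: equator_def)
    moreover have "- (\<Sum>i\<in>B. v' i) extreme_point_of P" if "B \<in> BB2" for B
      using that rB[of B] by (simp add: equator_def BB2_def)
    ultimately show "?R \<subseteq> ?E" by blast
  qed
  have \<sigma>2: "\<sigma> i * \<sigma> i = 1" for i using \<sigma>[of i] by auto
  have int_iff: "c' i \<bullet> x \<in> \<int> \<longleftrightarrow> c i \<bullet> x \<in> \<int>" for i x
    using \<sigma>[of i] by (auto simp: c'_def minus_in_Ints_iff)
  have "block_frame P v' c' BB BB2"
  proof
    show "c' i \<bullet> v' j = (if i = j then 1 else 0)" for i j
      by (simp add: c'_def v'_def dual \<sigma>2)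
    show "x = (\<Sum>i\<in>UNIV. (c' i \<bullet> x) *\<^sub>R v' i)" for x
    proof -
      have "(c' i \<bullet> x) *\<^sub>R v' i = (\<sigma> i * \<sigma> i) *\<^sub>R ((c i \<bullet> x) *\<^sub>R v i)" for i
        by (simp add: c'_def v'_def)
      then show ?thesis using expand[of x] by (simp add: \<sigma>2)
    qed
    show "v' i \<in> int_lattice" for i
      using \<sigma>[of i] extreme_int[OF ext] extreme_int[OF ext_neg] by (auto simp: v'_def)
    show "2 * (c' i \<bullet> x) \<in> \<int>" if "x \<in> int_lattice" for x i
      using \<sigma>[of i] half_int_coords[OF that, of i] by (auto simp: c'_def minus_in_Ints_iff)
    show "c' i \<bullet> x \<in> \<int>" if "x \<in> int_lattice" "B \<in> BB" "i \<in> B" for x B i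
    proof -
      \<comment> \<open>Some equator vertex is nonzero at \<open>i\<close>, which makes the
        functional \<open>c i\<close> itself integral.\<close>
      have "r B \<in> equator" "c i \<bullet> r B \<noteq> 0" using r[OF that(2)] that(3) by (auto simp: supp_def)
      then have "c i \<in> int_lattice"
        using equator_neg(2) equator_pos(2) by (metis linorder_neqE_linordered_idom)
      then show ?thesis unfolding int_iff using inner_int_lattice that(1) by blast
    qed
    show "even (card {i. c' i \<bullet> x \<notin> \<int>})" if "x \<in> int_lattice" for x
      unfolding int_iff by (rule even_half_coords[OF that])
    show "disjoint BB" unfolding disjoint_def using dj by blast
    show "even (card B)" if "B \<in> BB" for B
      using even_supp[OF r(1)[OF that]] r(2)[OF that] by simp
    show "BB2 \<subseteq> BB" by (auto simp: BB2_def)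
    show "P = convex hull (range v' \<union> range (\<lambda>i. - v' i) \<union> (\<lambda>B. \<Sum>i\<in>B. v' i) ` BB
      \<union> (\<lambda>B. - (\<Sum>i\<in>B. v' i)) ` BB2)"
      using reflexive_polytope(3)[OF reflexive] unfolding ext_eq .
  qed
  then show ?thesis by (rule that)
qed

end

section \<open>Counting lattice points\<close>

lemma gf_add_const:
  "finite_levels X (\<lambda>x. k + g x) = finite_levels X g" "gf X (\<lambda>x. k + g x) = fps_X ^ k * gf X g"
proof -
  have *: "{x\<in>X. k + g x = m} = (if m < k then {} else {x\<in>X. g x = m - k})" for m by auto
  show "finite_levels X (\<lambda>x. k + g x) = finite_levels X g"
    unfolding finite_levels_def * by auto
  show "gf X (\<lambda>x. k + g x) = fps_X ^ k * gf X g"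
    by (rule fps_ext) (simp add: gf_def * fps_X_power_mult_nth)
qed

lemma sum_card_levels:
  assumes "finite_levels X g"
  shows "finite {x\<in>X. g x \<le> m}" "card {x\<in>X. g x \<le> m} = (\<Sum>j\<le>m. card {x\<in>X. g x = j})"
proof -
  have *: "{x\<in>X. g x \<le> m} = (\<Union>j\<in>{..m}. {x\<in>X. g x = j})" by auto
  show "finite {x\<in>X. g x \<le> m}" unfolding * using assms by (simp add: finite_levels_def)
  show "card {x\<in>X. g x \<le> m} = (\<Sum>j\<le>m. card {x\<in>X. g x = j})"
    unfolding * using assms by (subst card_UN_disjoint) (auto simp: finite_levels_def)
qed

lemma scale_add:
  fixes P :: "'a::real_vector set"
  assumes "convex P" "x \<in> (\<lambda>p. s *\<^sub>R p) ` P" "y \<in> (\<lambda>p. r *\<^sub>R p) ` P" "0 \<le> s" "0 \<le> r"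
  shows "x + y \<in> (\<lambda>p. (s + r) *\<^sub>R p) ` P"
proof (cases "s + r = 0")
  case True
  then have "s = 0" "r = 0" using assms(4,5) by auto
  then show ?thesis using assms(2,3) by auto
next
  case False
  then have pos: "0 < s + r" using assms(4,5) by auto
  obtain p q where p: "p \<in> P" "x = s *\<^sub>R p" and q: "q \<in> P" "y = r *\<^sub>R q" using assms by blast
  have "(s / (s + r)) *\<^sub>R p + (r / (s + r)) *\<^sub>R q \<in> P"
    using pos assms(4,5) by (intro convexD[OF assms(1) p(1) q(1)]) (simp_all flip: add_divide_distrib)
  moreover have "x + y = (s + r) *\<^sub>R ((s / (s + r)) *\<^sub>R p + (r / (s + r)) *\<^sub>R q)"
    using pos p q by (simp add: scaleR_right_distrib)
  ultimately show ?thesis by blast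
qed

lemma scale_sum:
  fixes P :: "'a::real_vector set"
  assumes "convex P" "0 \<in> P" "finite I" "\<And>i. i \<in> I \<Longrightarrow> x i \<in> (\<lambda>p. s i *\<^sub>R p) ` P" "\<And>i. i \<in> I \<Longrightarrow> 0 \<le> s i"
  shows "(\<Sum>i\<in>I. x i) \<in> (\<lambda>p. (\<Sum>i\<in>I. s i) *\<^sub>R p) ` P"
  using assms(3-5)
proof (induction I rule: finite_induct)
  case empty
  then show ?case using assms(2) by auto
next
  case (insert j I)
  then show ?case using scale_add[OF assms(1), of "x j" "s j" "sum x I" "sum s I"]
    by (simp add: sum_nonneg)
qed

lemma scale_mono:
  fixes P :: "'a::real_vector set"
  assumes "convex P" "0 \<in> P" "x \<in> (\<lambda>p. s *\<^sub>R p) ` P" "0 \<le> s" "s \<le> r"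
  shows "x \<in> (\<lambda>p. r *\<^sub>R p) ` P"
proof -
  have "0 \<in> (\<lambda>p. (r - s) *\<^sub>R p) ` P" using assms(2) by force
  then show ?thesis using scale_add[OF assms(1,3) _ assms(4), of 0 "r - s"] assms(5) by simp
qed

section \<open>The gauge of the polytope in block coordinates\<close>

context block_frame
begin

definition J :: "'n set" where "J = - \<Union>BB"

definition wsum :: "'n set \<Rightarrow> real ^ 'n" where "wsum B = (\<Sum>i\<in>B. v i)"

lemma hull_wsum: "P = convex hull (range v \<union> range (\<lambda>i. - v i) \<union> wsum ` BB \<union> (\<lambda>B. - wsum B) ` BB2)"
  using hull by (simp add: wsum_def)

lemma block_unique: "A \<in> BB \<Longrightarrow> B \<in> BB \<Longrightarrow> i \<in> A \<Longrightarrow> i \<in> B \<Longrightarrow> A = B"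
  using disj unfolding disjoint_def by blast

lemma sum_split:
  fixes g :: "'n \<Rightarrow> 'b::comm_monoid_add"
  shows "(\<Sum>i\<in>UNIV. g i) = (\<Sum>i\<in>J. g i) + (\<Sum>B\<in>BB. \<Sum>i\<in>B. g i)"
proof -
  have "(\<Sum>i\<in>\<Union>BB. g i) = (\<Sum>B\<in>BB. \<Sum>i\<in>B. g i)"
    using disj unfolding disjoint_def by (subst sum.Union_disjoint) auto
  moreover have "(\<Sum>i\<in>UNIV. g i) = (\<Sum>i\<in>J. g i) + (\<Sum>i\<in>\<Union>BB. g i)"
    unfolding J_def by (subst sum.union_disjoint[symmetric]) (auto intro!: sum.cong)
  ultimately show ?thesis by simp
qed

lemma coord_wsum: "c i \<bullet> wsum B = (if i \<in> B then 1 else 0)"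
  by (simp add: wsum_def inner_sum_right dual)

text \<open>Only the blocks in \<open>BB2\<close> come with the generator \<open>- wsum B\<close>,
  so only they allow negative multiples.\<close>

definition admissible :: "('n set \<Rightarrow> real) \<Rightarrow> bool" where
  "admissible t \<longleftrightarrow> (\<forall>B\<in>BB - BB2. 0 \<le> t B)"

text \<open>The sum of the absolute coefficients when \<open>x\<close> is written with
  \<open>t B\<close> copies of each \<open>wsum B\<close> and the rest in the
  \<open>v i\<close>.\<close>

definition cost :: "real ^ 'n \<Rightarrow> ('n set \<Rightarrow> real) \<Rightarrow> real" where
  "cost x t = (\<Sum>i\<in>J. \<bar>c i \<bullet> x\<bar>) + (\<Sum>B\<in>BB. \<bar>t B\<bar> + (\<Sum>i\<in>B. \<bar>c i \<bullet> x - t B\<bar>))"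

lemma cost_add: "cost (x + y) (\<lambda>B. t B + s B) \<le> cost x t + cost y s"
proof -
  have "cost (x + y) (\<lambda>B. t B + s B) \<le> (\<Sum>i\<in>J. \<bar>c i \<bullet> x\<bar> + \<bar>c i \<bullet> y\<bar>) +
     (\<Sum>B\<in>BB. (\<bar>t B\<bar> + \<bar>s B\<bar>) + (\<Sum>i\<in>B. \<bar>c i \<bullet> x - t B\<bar> + \<bar>c i \<bullet> y - s B\<bar>))"
    unfolding cost_def inner_add_right by (intro add_mono sum_mono) linarith+
  also have "\<dots> = cost x t + cost y s"
    unfolding cost_def sum.distrib by linarith
  finally show ?thesis .
qed

lemma cost_scale: "0 \<le> a \<Longrightarrow> cost (a *\<^sub>R x) (\<lambda>B. a * t B) = a * cost x t"
  unfolding cost_def by (simp add: sum_distrib_left distrib_left abs_mult flip: right_diff_distrib)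

lemma cost_zero: "cost x (\<lambda>_. 0) = (\<Sum>i\<in>UNIV. \<bar>c i \<bullet> x\<bar>)"
  by (simp add: cost_def sum_split)

lemma cost_v: "cost (v i) (\<lambda>_. 0) = 1" "cost (- v i) (\<lambda>_. 0) = 1"
  unfolding cost_zero by (simp_all add: dual if_distrib[of abs] cong: if_cong)

lemma cost_wsum:
  assumes "B \<in> BB"
  shows "cost (wsum B) (\<lambda>A. if A = B then 1 else 0) = 1"
    "cost (- wsum B) (\<lambda>A. if A = B then - 1 else 0) = 1"
proof -
  have J: "i \<notin> B" if "i \<in> J" for i using that assms by (auto simp: J_def)
  have z: "(\<Sum>i\<in>A. \<bar>(if i \<in> B then 1 else 0) - (if A = B then 1 else 0)\<bar> :: real) = 0"
    if "A \<in> BB" for A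
    using block_unique[OF assms that] by (intro sum.neutral) auto
  have z': "(\<Sum>i\<in>A. \<bar>- (if i \<in> B then 1 else 0) - (if A = B then - 1 else 0)\<bar> :: real) = 0"
    if "A \<in> BB" for A
    using block_unique[OF assms that] by (intro sum.neutral) auto
  show "cost (wsum B) (\<lambda>A. if A = B then 1 else 0) = 1"
    "cost (- wsum B) (\<lambda>A. if A = B then - 1 else 0) = 1"
    unfolding cost_def inner_minus_right coord_wsum using J z z' assms
    by (simp_all add: if_distrib[of abs] cong: if_cong)
qed

text \<open>The points of cost at most 1 form a convex set containing the generators. Conversely, a
  decomposition is a sum of scaled generators whose dilation factors add up to the cost.\<close>

lemma in_scaled_iff:
  assumes "0 \<le> m" and P0: "0 \<in> P"
  shows "x \<in> (\<lambda>p. m *\<^sub>R p) ` P \<longleftrightarrow> (\<exists>t. admissible t \<and> cost x t \<le> m)"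
proof
  define Q where "Q = {p. \<exists>t. admissible t \<and> cost p t \<le> 1}"
  have "convex Q"
  proof (rule convexI)
    fix x y and a b :: real
    assume "x \<in> Q" "y \<in> Q" and ab: "0 \<le> a" "0 \<le> b" "a + b = 1"
    then obtain t s where t: "admissible t" "cost x t \<le> 1" and s: "admissible s" "cost y s \<le> 1"
      by (auto simp: Q_def)
    have "cost (a *\<^sub>R x + b *\<^sub>R y) (\<lambda>B. a * t B + b * s B) \<le> a * cost x t + b * cost y s"
      using cost_add[of "a *\<^sub>R x" "b *\<^sub>R y" "\<lambda>B. a * t B" "\<lambda>B. b * s B"] ab
      by (simp only: cost_scale)
    also have "\<dots> \<le> a * 1 + b * 1" using t s ab by (intro add_mono mult_left_mono)
    finally have "cost (a *\<^sub>R x + b *\<^sub>R y) (\<lambda>B. a * t B + b * s B) \<le> 1" using ab by simp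
    moreover have "admissible (\<lambda>B. a * t B + b * s B)"
      using t s ab by (simp add: admissible_def)
    ultimately show "a *\<^sub>R x + b *\<^sub>R y \<in> Q" by (auto simp: Q_def)
  qed
  moreover have "v i \<in> Q" "- v i \<in> Q" for i
    unfolding Q_def by (auto intro!: exI[of _ "\<lambda>_. 0"] simp: cost_v admissible_def)
  moreover have "wsum B \<in> Q" if "B \<in> BB" for B
    unfolding Q_def using cost_wsum(1)[OF that]
    by (auto intro!: exI[of _ "\<lambda>A. if A = B then 1 else 0"] simp: admissible_def)
  moreover have "- wsum B \<in> Q" if "B \<in> BB2" for B
    unfolding Q_def using cost_wsum(2)[of B] that sub
    by (auto intro!: exI[of _ "\<lambda>A. if A = B then - 1 else 0"] simp: admissible_def)
  ultimately have PQ: "P \<subseteq> Q"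
    unfolding hull_wsum by (intro hull_minimal) auto
  assume "x \<in> (\<lambda>p. m *\<^sub>R p) ` P"
  then obtain p where p: "p \<in> P" "x = m *\<^sub>R p" by blast
  then obtain t where "admissible t" "cost p t \<le> 1" using PQ by (auto simp: Q_def)
  then have "admissible (\<lambda>B. m * t B)" "cost x (\<lambda>B. m * t B) \<le> m"
    using assms(1) p by (auto simp: admissible_def cost_scale mult_left_le)
  then show "\<exists>t. admissible t \<and> cost x t \<le> m" by blast
next
  have cv: "convex P" unfolding hull by simp
  define K where "K s = (\<lambda>p. s *\<^sub>R p) ` P" for s :: real
  have gens: "v i \<in> P" "- v i \<in> P" "B \<in> BB \<Longrightarrow> wsum B \<in> P" "B \<in> BB2 \<Longrightarrow> - wsum B \<in> P" for i B
    unfolding hull_wsum by (auto intro!: hull_inc)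
  have Kv: "a *\<^sub>R v i \<in> K \<bar>a\<bar>" for a i
    using gens(1,2)[of i] unfolding K_def by (cases "0 \<le> a") force+
  have Kw: "t B *\<^sub>R wsum B \<in> K \<bar>t B\<bar>" if "admissible t" "B \<in> BB" for t B
  proof (cases "0 \<le> t B")
    case True
    then show ?thesis using gens(3)[OF that(2)] unfolding K_def by force
  next
    case False
    then have "B \<in> BB2" using that by (auto simp: admissible_def)
    then show ?thesis using gens(4)[of B] False unfolding K_def by force
  qed
  note Kadd = scale_add[OF cv, folded K_def]
  note Ksum = scale_sum[OF cv P0, folded K_def]
  assume "\<exists>t. admissible t \<and> cost x t \<le> m"
  then obtain t where t: "admissible t" "cost x t \<le> m" by blast
  have "(\<Sum>i\<in>J. (c i \<bullet> x) *\<^sub>R v i) + (\<Sum>B\<in>BB. t B *\<^sub>R wsum B + (\<Sum>i\<in>B. (c i \<bullet> x - t B) *\<^sub>R v i)) \<in> K (cost x t)"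
    unfolding cost_def
    by (intro Kadd Ksum Kv Kw t(1) sum_nonneg add_nonneg_nonneg) auto
  also have "(\<Sum>i\<in>J. (c i \<bullet> x) *\<^sub>R v i) + (\<Sum>B\<in>BB. t B *\<^sub>R wsum B + (\<Sum>i\<in>B. (c i \<bullet> x - t B) *\<^sub>R v i)) = x"
  proof -
    have "t B *\<^sub>R wsum B + (\<Sum>i\<in>B. (c i \<bullet> x - t B) *\<^sub>R v i) = (\<Sum>i\<in>B. (c i \<bullet> x) *\<^sub>R v i)" for B
      unfolding wsum_def scaleR_sum_right
      by (simp add: scaleR_left_diff_distrib flip: sum.distrib)
    then show ?thesis by (subst (4) expand) (simp add: sum_split)
  qed
  finally have "x \<in> K (cost x t)" .
  moreover have "0 \<le> cost x t"
    unfolding cost_def by (intro add_nonneg_nonneg sum_nonneg) auto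
  ultimately show "x \<in> (\<lambda>p. m *\<^sub>R p) ` P"
    using scale_mono[OF cv P0] t(2) unfolding K_def by blast
qed

section \<open>Lattice points in half-integral coordinates\<close>

definition halves :: "'n set set" where
  "halves = (\<lambda>x. {i. c i \<bullet> x \<notin> \<int>}) ` int_lattice"

text \<open>Lattice points are indexed by the set \<open>S\<close> of their half-integral
  coordinates and the floors \<open>z\<close> of all coordinates.\<close>

definition pt :: "'n set \<times> ('n \<Rightarrow> int) \<Rightarrow> real ^ 'n" where
  "pt = (\<lambda>(S, z). \<Sum>i\<in>UNIV. (of_int (z i) + (if i \<in> S then 1 / 2 else 0)) *\<^sub>R v i)"

lemma coord_pt: "c i \<bullet> pt (S, z) = of_int (z i) + (if i \<in> S then 1 / 2 else 0)"
  by (simp add: pt_def inner_sum_right dual if_distrib[of "\<lambda>a. _ * a"] cong: if_cong)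

lemma halves_sub: "S \<in> halves \<Longrightarrow> S \<subseteq> J"
  and even_halves: "S \<in> halves \<Longrightarrow> even (card S)"
  using block_int even_half by (auto simp: halves_def J_def)

lemma half_notin_Ints: "of_int k + 1 / 2 \<notin> (\<int> :: real set)"
proof
  assume "of_int k + 1 / 2 \<in> (\<int> :: real set)"
  then obtain m where "of_int k + 1 / 2 = (of_int m :: real)" by (auto elim: Ints_cases)
  then have "2 * k + 1 = 2 * m" by linarith
  then show False by presburger
qed

lemma half_odd:
  fixes a :: real
  assumes "2 * a \<in> \<int>" "a \<notin> \<int>"
  shows "a = of_int \<lfloor>a\<rfloor> + 1 / 2"
proof -
  obtain m where m: "2 * a = of_int m" using assms(1) by (auto elim: Ints_cases)
  have "odd m" using m assms(2) by (auto elim!: evenE)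
  then obtain n where "m = 2 * n + 1" by (elim oddE)
  then have "a = of_int n + 1 / 2" using m by simp
  moreover from this have "\<lfloor>a\<rfloor> = n" by linarith
  ultimately show ?thesis by simp
qed

text \<open>Points with the same half-integral coordinates differ by an integral combination of the
  lattice points \<open>v i\<close>. So once one lattice point has half-integral set
  \<open>S\<close>, every choice of \<open>z\<close> gives a lattice point.\<close>

lemma bij_betw_pt: "bij_betw pt (halves \<times> UNIV) int_lattice"
  unfolding bij_betw_def
proof
  show "inj_on pt (halves \<times> UNIV)"
  proof (rule inj_onI, clarify)
    fix S z S' z' assume eq: "pt (S, z) = pt (S', z')"
    have "S = {i. c i \<bullet> pt (S, z) \<notin> \<int>}" for S and z :: "'n \<Rightarrow> int"
      using half_notin_Ints by (auto simp: coord_pt)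
    then have S: "S = S'" using eq by metis
    moreover have "z i = z' i" for i
      using arg_cong[OF eq, of "inner (c i)"] unfolding coord_pt S by simp
    ultimately show "S = S' \<and> z = z'" by blast
  qed
  show "pt ` (halves \<times> UNIV) = int_lattice"
  proof (intro set_eqI iffI)
    fix x assume "x \<in> pt ` (halves \<times> UNIV)"
    then obtain S z where x: "x = pt (S, z)" "S \<in> halves" by blast
    then obtain y where y: "y \<in> int_lattice" "S = {i. c i \<bullet> y \<notin> \<int>}" by (auto simp: halves_def)
    have "c i \<bullet> (x - y) \<in> \<int>" for i
    proof (cases "i \<in> S")
      case True
      then have "c i \<bullet> y = of_int \<lfloor>c i \<bullet> y\<rfloor> + 1 / 2"
        using half_odd[OF half_int[OF y(1), of i]] y(2) by simp
      then have "c i \<bullet> (x - y) = of_int (z i - \<lfloor>c i \<bullet> y\<rfloor>)"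
        using True by (simp add: inner_diff_right x coord_pt)
      then show ?thesis by (simp only: Ints_of_int)
    next
      case False
      then show ?thesis using y(2) by (simp add: inner_diff_right x coord_pt)
    qed
    then have "x - y \<in> int_lattice"
      by (subst expand) (intro int_lattice_sum int_lattice_scale v_int)
    then have "(x - y) + y \<in> int_lattice" using y(1) by (rule int_lattice_add)
    then show "x \<in> int_lattice" by simp
  next
    fix x :: "real ^ 'n" assume x: "x \<in> int_lattice"
    let ?S = "{i. c i \<bullet> x \<notin> \<int>}"
    have "c i \<bullet> x = of_int \<lfloor>c i \<bullet> x\<rfloor> + (if i \<in> ?S then 1 / 2 else 0)" for i
      using half_odd[OF half_int[OF x, of i]] by simp
    then have "x = pt (?S, \<lambda>i. \<lfloor>c i \<bullet> x\<rfloor>)"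
      unfolding pt_def by (subst expand) simp
    moreover have "?S \<in> halves" using x by (auto simp: halves_def)
    ultimately show "x \<in> pt ` (halves \<times> UNIV)" by blast
  qed
qed

definition weight1 :: "'n set \<Rightarrow> 'n \<Rightarrow> int \<Rightarrow> nat" where
  "weight1 S i a = (if i \<in> S then half_weight a else nat \<bar>a\<bar>)"

definition weightB :: "'n set \<Rightarrow> ('n \<Rightarrow> int) \<Rightarrow> nat" where
  "weightB B = (if B \<in> BB2 then gauge2 B else gauge1 B)"

text \<open>For \<open>S\<close> in \<open>halves\<close> this is the gauge of
  \<open>pt (S, z)\<close>. A coordinate in \<open>S\<close> has absolute value
  \<open>half_weight\<close> plus 1/2, and the halves add up to \<open>card S div 2\<close> because
  \<open>card S\<close> is even.\<close>

definition weight :: "'n set \<Rightarrow> ('n \<Rightarrow> int) \<Rightarrow> nat" where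
  "weight S z = card S div 2 + ((\<Sum>i\<in>J. weight1 S i (z i)) + (\<Sum>B\<in>BB. weightB B (restrict z B)))"

lemma sum_weight1:
  assumes "S \<in> halves"
  shows "(\<Sum>i\<in>J. \<bar>c i \<bullet> pt (S, z)\<bar>) = real (card S div 2) + (\<Sum>i\<in>J. real (weight1 S i (z i)))"
proof -
  have "(\<Sum>i\<in>J. \<bar>c i \<bullet> pt (S, z)\<bar>) = (\<Sum>i\<in>J. real (weight1 S i (z i)) + (if i \<in> S then 1 / 2 else 0))"
    by (rule sum.cong) (auto simp: coord_pt weight1_def half_weight_def)
  also have "\<dots> = (\<Sum>i\<in>J. real (weight1 S i (z i))) + real (card S) / 2"
    using halves_sub[OF assms] by (simp add: sum.distrib sum.If_cases Int_absorb1)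
  also have "real (card S) / 2 = real (card S div 2)"
    using even_halves[OF assms] by (simp add: real_of_nat_div)
  finally show ?thesis by simp
qed

lemma block_coord_pt: "S \<in> halves \<Longrightarrow> B \<in> BB \<Longrightarrow> i \<in> B \<Longrightarrow> c i \<bullet> pt (S, z) = of_int (z i)"
  using halves_sub unfolding J_def by (auto simp: coord_pt)

text \<open>The real minimisation over \<open>t\<close> splits into one problem per block, and the
  block gauges solve these with integers as minimisers.\<close>

lemma in_scaled_pt_iff:
  assumes S: "S \<in> halves" and P0: "0 \<in> P"
  shows "pt (S, z) \<in> (\<lambda>p. real m *\<^sub>R p) ` P \<longleftrightarrow> weight S z \<le> m"
proof -
  have cost: "cost (pt (S, z)) t = real (card S div 2) + ((\<Sum>i\<in>J. real (weight1 S i (z i))) +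
      (\<Sum>B\<in>BB. \<bar>t B\<bar> + (\<Sum>i\<in>B. \<bar>of_int (restrict z B i) - t B\<bar>)))" for t
  proof -
    have "(\<Sum>B\<in>BB. \<bar>t B\<bar> + (\<Sum>i\<in>B. \<bar>c i \<bullet> pt (S, z) - t B\<bar>)) =
        (\<Sum>B\<in>BB. \<bar>t B\<bar> + (\<Sum>i\<in>B. \<bar>of_int (restrict z B i) - t B\<bar>))"
      by (intro sum.cong refl arg_cong2[where f = plus]) (simp add: block_coord_pt[OF S])
    then show ?thesis by (simp only: cost_def sum_weight1[OF S] add.assoc)
  qed
  have w: "real (weight S z) = real (card S div 2) + ((\<Sum>i\<in>J. real (weight1 S i (z i))) +
      (\<Sum>B\<in>BB. real (weightB B (restrict z B))))"
    by (simp add: weight_def)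
  have le: "real (weight S z) \<le> cost (pt (S, z)) t" if "admissible t" for t
    unfolding w cost
  proof (intro add_left_mono sum_mono)
    fix B assume B: "B \<in> BB"
    show "real (weightB B (restrict z B)) \<le> \<bar>t B\<bar> + (\<Sum>i\<in>B. \<bar>of_int (restrict z B i) - t B\<bar>)"
    proof (cases "B \<in> BB2")
      case True
      then show ?thesis
        using gauge2_le[of B "restrict z B" "t B"] even_card[OF B] by (simp only: weightB_def if_True finite_code)
    next
      case False
      then have "0 \<le> t B" using that B by (simp add: admissible_def)
      then show ?thesis using False
        gauge1_le[of B "t B" "restrict z B"] even_card[OF B] by (simp only: weightB_def if_False abs_of_nonneg finite_code)
    qed
  qed
  have "\<exists>a::int. (B \<in> BB - BB2 \<longrightarrow> 0 \<le> a) \<and> real (weightB B (restrict z B)) =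
      \<bar>of_int a\<bar> + (\<Sum>i\<in>B. \<bar>of_int (restrict z B i) - of_int a\<bar>)" for B
  proof (cases "B \<in> BB2")
    case True
    then show ?thesis using gauge2_attained[of B "restrict z B"] by (simp only: weightB_def if_True) blast
  next
    case False
    obtain a :: int where "0 \<le> a" "real (gauge1 B (restrict z B)) =
        of_int a + (\<Sum>i\<in>B. \<bar>of_int (restrict z B i) - of_int a\<bar>)"
      using gauge1_attained by blast
    then show ?thesis using False by (intro exI[of _ a]) (simp only: weightB_def if_False, simp)
  qed
  then obtain a :: "'n set \<Rightarrow> int" where a: "\<And>B. B \<in> BB - BB2 \<Longrightarrow> 0 \<le> a B"
    "\<And>B. real (weightB B (restrict z B)) =
      \<bar>of_int (a B)\<bar> + (\<Sum>i\<in>B. \<bar>of_int (restrict z B i) - of_int (a B)\<bar>)"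
    by metis
  have "cost (pt (S, z)) (\<lambda>B. of_int (a B)) = real (weight S z)"
    unfolding w cost a(2) ..
  moreover have "admissible (\<lambda>B. of_int (a B))" using a(1) by (auto simp: admissible_def)
  ultimately have "(\<exists>t. admissible t \<and> cost (pt (S, z)) t \<le> real m) \<longleftrightarrow> real (weight S z) \<le> real m"
    using le order.trans by metis
  then show ?thesis using in_scaled_iff[of "real m"] P0 by simp
qed

section \<open>The numerator and its gamma-positivity\<close>

text \<open>The numerator of the block series over \<open>(1 - t) ^ card B\<close>; the correction
  counts twice when the negative of the block sum is a generator too.\<close>

definition comp_poly :: "'n set \<Rightarrow> real poly" where
  "comp_poly B = [:1, 1:] ^ card B + smult (if B \<in> BB2 then 2 else 1) (block_poly (card B div 2))"

text \<open>The numerator contributed by the lattice points with half-integral set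
  \<open>S\<close>.\<close>

definition half_poly :: "'n set \<Rightarrow> real poly" where
  "half_poly S = smult (2 ^ card S) (monom 1 (card S div 2)) * [:1, 1:] ^ card (J - S) * (\<Prod>B\<in>BB. comp_poly B)"

lemma card_UNIV_split: "CARD('n) = card J + (\<Sum>B\<in>BB. card B)"
  using sum_split[of "\<lambda>_. 1 :: nat"] by simp

text \<open>The weight is additive over the coordinates in \<open>J\<close> and over the blocks, so
  its series factors; every coordinate accounts for one factor \<open>1 - t\<close> of the
  denominator.\<close>

lemma gf_weight:
  assumes "S \<in> halves"
  shows "finite_levels UNIV (weight S)"
    "(1 - fps_X) ^ CARD('n) * gf UNIV (weight S) = fps_of_poly (half_poly S)"
proof -
  define q :: "real fps" where "q = inverse (1 - fps_X)"
  have q: "(1 - fps_X) * q = 1" unfolding q_def by (rule inverse_mult_eq_1') simp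
  let ?X = "\<lambda>_::'n. UNIV :: int set"
  have SJ: "S \<subseteq> J" by (rule halves_sub[OF assms])
  have J1: "finite_levels (int_vecs J) (\<lambda>z. \<Sum>i\<in>J. weight1 S i (z i)) \<and>
     gf (int_vecs J) (\<lambda>z. \<Sum>i\<in>J. weight1 S i (z i)) = (\<Prod>i\<in>J. gf UNIV (weight1 S i))"
  proof (rule gf_PiE)
    show "finite_levels UNIV (weight1 S i)" for i
      using finite_levels_half finite_levels_abs[of UNIV] by (cases "i \<in> S") (simp_all add: weight1_def[abs_def])
  qed simp
  have "gf UNIV (weight1 S i) = (if i \<in> S then 2 else 1 + fps_X) * q" for i
    by (cases "i \<in> S") (simp_all add: weight1_def[abs_def] gf_half gf_abs q_def)
  then have "(\<Prod>i\<in>J. gf UNIV (weight1 S i)) = (\<Prod>i\<in>J. if i \<in> S then 2 else 1 + fps_X) * q ^ card J"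
    by (simp add: prod.distrib)
  also have "(\<Prod>i\<in>J. if i \<in> S then 2 else 1 + fps_X :: real fps) = 2 ^ card S * (1 + fps_X) ^ card (J - S)"
    using SJ by (simp add: prod.If_cases Int_absorb1 Diff_eq)
  finally have J2: "(1 - fps_X) ^ card J * (\<Prod>i\<in>J. gf UNIV (weight1 S i)) = 2 ^ card S * (1 + fps_X) ^ card (J - S)"
    using q by (simp add: mult.left_commute flip: power_mult_distrib)
  have B: "finite_levels (int_vecs B) (weightB B) \<and>
      (1 - fps_X) ^ card B * gf (int_vecs B) (weightB B) = fps_of_poly (comp_poly B)" if "B \<in> BB" for B
  proof -
    have k: "card B = 2 * (card B div 2)" using even_card[OF that] by simp
    show ?thesis
    proof (cases "B \<in> BB2")
      case True
      then show ?thesis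
        using finite_levels_gauge2[OF _ k] gf_gauge2[OF _ k] k by (simp add: weightB_def comp_poly_def)
    next
      case False
      then show ?thesis
        using finite_levels_gauge1[OF _ k order.refl] gf_gauge1[OF _ k] k by (simp add: weightB_def comp_poly_def)
    qed
  qed
  have B1: "finite_levels (int_vecs (\<Union>BB)) (\<lambda>z. \<Sum>B\<in>BB. weightB B (restrict z B)) \<and>
     gf (int_vecs (\<Union>BB)) (\<lambda>z. \<Sum>B\<in>BB. weightB B (restrict z B)) = (\<Prod>B\<in>BB. gf (int_vecs B) (weightB B))"
    by (rule gf_PiE_partition) (use disj B in auto)
  have B2: "(1 - fps_X) ^ (\<Sum>B\<in>BB. card B) * (\<Prod>B\<in>BB. gf (int_vecs B) (weightB B)) = (\<Prod>B\<in>BB. fps_of_poly (comp_poly B))"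
    unfolding power_sum prod.distrib[symmetric] using B by (intro prod.cong) auto
  define g where "g = (\<lambda>z. (\<Sum>i\<in>J. weight1 S i (z i)) + (\<Sum>B\<in>BB. weightB B (restrict z B)))"
  define G1 where "G1 = (\<lambda>z. \<Sum>i\<in>J. weight1 S i (z i))"
  define G2 where "G2 = (\<lambda>z. \<Sum>B\<in>BB. weightB B (restrict z B))"
  have U: "J \<union> \<Union>BB = UNIV" "J \<inter> \<Union>BB = {}" by (auto simp: J_def)
  have bij: "bij_betw (\<lambda>z. (restrict z J, restrict z (\<Union>BB))) UNIV (int_vecs J \<times> int_vecs (\<Union>BB))"
    using bij_betw_PiE_Un[OF U(2), of ?X] unfolding U(1) by simp
  have g: "(\<lambda>(x, y). G1 x + G2 y) (restrict z J, restrict z (\<Union>BB)) = g z" for z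
  proof -
    have "restrict (restrict z (\<Union>BB)) B = restrict z B" if "B \<in> BB" for B
      using that by (auto simp: fun_eq_iff)
    then show ?thesis by (simp add: G1_def G2_def g_def)
  qed
  note G1 = J1[folded G1_def] and G2 = B1[folded G2_def]
  have fg: "finite_levels UNIV g"
    using finite_levels_reindex[of _ _ _ "\<lambda>(x, y). G1 x + G2 y", OF bij g]
      finite_levels_Times[OF G1[THEN conjunct1] G2[THEN conjunct1]] by simp
  have w: "weight S = (\<lambda>z. card S div 2 + g z)" by (simp add: weight_def g_def fun_eq_iff)
  show "finite_levels UNIV (weight S)" unfolding w gf_add_const(1) by (rule fg)
  have "gf UNIV g = (\<Prod>i\<in>J. gf UNIV (weight1 S i)) * (\<Prod>B\<in>BB. gf (int_vecs B) (weightB B))"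
    by (simp only: gf_reindex[of _ _ _ "\<lambda>(x, y). G1 x + G2 y", OF bij g]
        gf_Times[OF G1[THEN conjunct1] G2[THEN conjunct1]] G1[THEN conjunct2] G2[THEN conjunct2])
  then have "(1 - fps_X) ^ CARD('n) * gf UNIV (weight S) = fps_X ^ (card S div 2) *
      ((1 - fps_X) ^ card J * (\<Prod>i\<in>J. gf UNIV (weight1 S i))) *
      ((1 - fps_X) ^ (\<Sum>B\<in>BB. card B) * (\<Prod>B\<in>BB. gf (int_vecs B) (weightB B)))"
    unfolding w gf_add_const(2) card_UNIV_split power_add by (simp only: mult_ac)
  also have "\<dots> = fps_of_poly (half_poly S)"
    unfolding J2 B2 half_poly_def
    by (simp add: fps_of_poly_mult fps_of_poly_smult fps_of_poly_monom fps_of_poly_linear_power fps_of_poly_prod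
        mult_ac numeral_fps_const fps_const_power)
  finally show "(1 - fps_X) ^ CARD('n) * gf UNIV (weight S) = fps_of_poly (half_poly S)" .
qed

text \<open>The factors have degree parameters \<open>card S\<close>, \<open>card (J - S)\<close>
  and the block sizes, which add up to \<open>CARD('n)\<close>. The monomial is a basis element
  since \<open>card S\<close> is even.\<close>

lemma gamma_nonneg_half_poly:
  assumes "S \<in> halves"
  shows "gamma_nonneg CARD('n) (half_poly S)"
proof -
  have "gamma_nonneg (card B) (comp_poly B)" if "B \<in> BB" for B
    unfolding comp_poly_def using gamma_nonneg_block_poly[of "card B div 2"] even_card[OF that]
    by (intro gamma_nonneg_add gamma_nonneg_linear_power gamma_nonneg_smult) auto
  then have "gamma_nonneg (\<Sum>B\<in>BB. card B) (\<Prod>B\<in>BB. comp_poly B)" by (rule gamma_nonneg_prod)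
  moreover have "gamma_nonneg (card S) (smult (2 ^ card S) (monom 1 (card S div 2)))"
    using gamma_nonneg_basis[of "card S div 2" "card S"] even_halves[OF assms]
    by (intro gamma_nonneg_smult) auto
  ultimately have "gamma_nonneg (card S + card (J - S) + (\<Sum>B\<in>BB. card B)) (half_poly S)"
    unfolding half_poly_def by (intro gamma_nonneg_mult gamma_nonneg_linear_power)
  moreover have "card S + card (J - S) = card J"
    using halves_sub[OF assms] by (simp add: card_Diff_subset card_mono)
  ultimately show ?thesis by (simp add: card_UNIV_split)
qed

text \<open>Lattice points of the \<open>m\<close>-th dilate are those of weight at most
  \<open>m\<close>. Summing the levels up to \<open>m\<close> gives the extra factor
  \<open>1 / (1 - t)\<close>.\<close>

lemma ehrhart_series_eq:
  assumes P0: "0 \<in> P"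
  shows "ehrhart_series P = fps_of_poly (\<Sum>S\<in>halves. half_poly S) / (1 - fps_X) ^ (CARD('n) + 1)"
proof -
  define q :: "real fps" where "q = inverse (1 - fps_X)"
  have q: "(1 - fps_X) * q = 1" unfolding q_def by (rule inverse_mult_eq_1') simp
  define a where "a = (\<Sum>S\<in>halves. gf UNIV (weight S))"
  have count: "real (card ((\<lambda>x. real m *\<^sub>R x) ` P \<inter> int_lattice)) = (\<Sum>j\<le>m. fps_nth a j)" for m
  proof -
    have Sigma: "(SIGMA S:halves. {z. weight S z \<le> m}) =
        {p\<in>halves \<times> UNIV. pt p \<in> (\<lambda>x. real m *\<^sub>R x) ` P}"
    proof (rule set_eqI)
      fix p
      show "p \<in> (SIGMA S:halves. {z. weight S z \<le> m}) \<longleftrightarrow>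
          p \<in> {p\<in>halves \<times> UNIV. pt p \<in> (\<lambda>x. real m *\<^sub>R x) ` P}"
        by (cases p) (simp add: in_scaled_pt_iff[OF _ P0] cong: conj_cong)
    qed
    have "bij_betw pt (SIGMA S:halves. {z. weight S z \<le> m}) ((\<lambda>x. real m *\<^sub>R x) ` P \<inter> int_lattice)"
    proof (rule bij_betw_subset[OF bij_betw_pt])
      show "(SIGMA S:halves. {z. weight S z \<le> m}) \<subseteq> halves \<times> UNIV" by auto
      have image_filter: "pt ` {p\<in>A. pt p \<in> K} = K \<inter> pt ` A" for A K by blast
      have "pt ` (halves \<times> UNIV) = int_lattice" using bij_betw_pt by (simp add: bij_betw_def)
      then show "pt ` (SIGMA S:halves. {z. weight S z \<le> m}) = (\<lambda>x. real m *\<^sub>R x) ` P \<inter> int_lattice"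
        unfolding Sigma image_filter by simp
    qed
    then have "card ((\<lambda>x. real m *\<^sub>R x) ` P \<inter> int_lattice) = card (SIGMA S:halves. {z. weight S z \<le> m})"
      by (simp add: bij_betw_same_card)
    also have "\<dots> = (\<Sum>S\<in>halves. card {z. weight S z \<le> m})"
      using sum_card_levels(1)[OF gf_weight(1)] by (intro card_SigmaI) auto
    also have "\<dots> = (\<Sum>S\<in>halves. \<Sum>j\<le>m. card {z. weight S z = j})"
      using sum_card_levels(2)[OF gf_weight(1)] by (intro sum.cong) auto
    finally show ?thesis
      by (simp add: a_def fps_sum_nth gf_def sum.swap[of _ halves])
  qed
  have "ehrhart_series P = a * q"
  proof (rule fps_ext)
    fix m
    \<comment> \<open>At \<open>m = 0\<close> the dilate is the origin alone, in agreement with the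
      value 1 fixed for the series.\<close>
    have "(\<lambda>x. real 0 *\<^sub>R x) ` P = {0}" using P0 by auto
    moreover have "0 \<in> int_lattice" by (simp add: int_lattice_def)
    ultimately have "real (card ((\<lambda>x. real 0 *\<^sub>R x) ` P \<inter> int_lattice)) = 1"
      by (simp add: Int_insert_left)
    then have "fps_nth (ehrhart_series P) m = real (card ((\<lambda>x. real m *\<^sub>R x) ` P \<inter> int_lattice))"
      by (cases "m = 0") (simp_all add: ehrhart_series_def)
    then show "fps_nth (ehrhart_series P) m = fps_nth (a * q) m"
      unfolding count by (simp add: fps_mult_nth q_def fps_inverse_one_minus_fps_X atLeast0AtMost)
  qed
  moreover have "fps_of_poly (\<Sum>S\<in>halves. half_poly S) = (1 - fps_X) ^ CARD('n) * a"
    unfolding a_def sum_distrib_left fps_of_poly_sum using gf_weight(2) by (intro sum.cong) auto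
  moreover have "(1 - fps_X) ^ CARD('n) * a / (1 - fps_X) ^ (CARD('n) + 1) = a * q"
  proof -
    have "inverse ((1 - fps_X :: real fps) ^ (CARD('n) + 1)) = q ^ (CARD('n) + 1)"
      unfolding q_def by (simp only: fps_inverse_power)
    moreover have "(1 - fps_X) ^ CARD('n) * q ^ CARD('n) = 1"
      using q by (simp flip: power_mult_distrib)
    ultimately show ?thesis
      by (subst fps_divide_unit) (simp_all add: fps_nth_power_0 mult_ac)
  qed
  ultimately show ?thesis by simp
qed

lemma gamma_positive_hstar:
  assumes "0 \<in> P"
  shows "gamma_positive (hstar_poly P)"
proof -
  let ?h = "\<Sum>S\<in>halves. half_poly S"
  have "hstar_poly P = ?h" by (rule hstar_poly_eqI[OF ehrhart_series_eq[OF assms]])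
  moreover have "gamma_nonneg CARD('n) ?h"
    by (intro gamma_nonneg_sum gamma_nonneg_half_poly)
  \<comment> \<open>The constant term is the coefficient of the Ehrhart series at 0;
    \<open>gamma_positiveI\<close> requires it to be nonzero.\<close>
  moreover have "coeff ?h 0 = 1"
  proof -
    let ?u = "(1 - fps_X :: real fps) ^ (CARD('n) + 1)"
    have u: "fps_nth ?u 0 = 1" by (simp add: fps_nth_power_0)
    have "1 = fps_nth (ehrhart_series P) 0" by (simp add: ehrhart_series_def)
    also have "\<dots> = fps_nth (fps_of_poly ?h * inverse ?u) 0"
      unfolding ehrhart_series_eq[OF assms] by (subst fps_divide_unit) (simp_all add: u)
    also have "\<dots> = coeff ?h 0" by (simp only: fps_mult_nth_0 fps_inverse_nth_0 u) simp
    finally show ?thesis by simp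
  qed
  ultimately show ?thesis using gamma_positiveI by fastforce
qed

end

theorem theorem4p8:
  fixes P :: "(real ^ 'n) set"
  assumes "reflexive P" and "simplicial P" and "pseudo_symmetric P"
  shows "gamma_positive (hstar_poly P)"
proof -
  obtain v c :: "'n \<Rightarrow> real ^ 'n" and u where "facet_frame P v c u"
    by (rule facet_frame_exists[OF assms])
  then obtain v' c' :: "'n \<Rightarrow> real ^ 'n" and BB BB2 where "block_frame P v' c' BB BB2"
    by (rule facet_frame.block_frame_exists)
  moreover have "0 \<in> P" using assms(1) interior_subset unfolding reflexive_def by blast
  ultimately show ?thesis by (rule block_frame.gamma_positive_hstar)
qed

end
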